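(* Let $1\le k\le d$ be integers, let $E:\mathbb{R}^d\to\mathbb{R}$ be a $C^3$ function, let $x^*,m^*\in\mathbb{R}^d$ and $l^*\in\mathbb{R}$, and let $v_1^*,\dots,v_k^*\in\mathbb{R}^d$ satisfy $\|v_i^*\|_2=1$ for $1\le i\le k$. Assume that the Hessian $\nabla^2E(x^* )$ is non-degenerate with eigenvalues $\lambda_1^*<\cdots<\lambda_k^*<0<\lambda_{k+1}^*\le\cdots\le\lambda_d^*$, and that $\alpha_1,\alpha_2,\zeta>0$ satisfy $\alpha_1^2\le 4\alpha_2\mu^*$, where $\mu^*=\min\{|\lambda_i^*| : i=1,\dots,k\}$. Then the following two statements are equivalent: (A) $(x^*,m^*,v_1^*,\dots,v_k^*,l^* )$ is a linearly stable steady state of the accelerated high-index saddle dynamics (A-HiSD) $$\left\{\begin{aligned} \dot x&=m,\\ \dot m&=-\alpha_1 m-\alpha_2\Big(I-2\sum_{i=1}^k v_iv_i^\top\Big)\nabla E(x),\\ \dot v_i&=-\zeta\Big(I-v_iv_i^\top-2\sum_{j=1}^{i-1}v_jv_j^\top\Big)H(x,v_i,l),\quad i=1,\dots,k,\\ \dot l&=-l. \end{aligned}\right.$$ (B) $x^*$ is an index-$k$ saddle point of $E$, $v_1^*,\dots,v_k^*$ are eigenvectors of $\nabla^2E(x^* )$ with corresponding eigenvalues $\lambda_1^*,\dots,\lambda_k^*$ (i.e. $\nabla^2E(x^* )v_i^*=\lambda_i^*v_i^*$ for $1\le i\le k$), and $m^*=l^*=0$.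
   Context: The unknowns are $x,m,v_1,\dots,v_k\in\mathbb{R}^d$ and $l\in\mathbb{R}$; $\|\cdot\|_2$ is the Euclidean norm. The function $H$ is the dimer approximation of the Hessian-vector product, $$H(x,v,l)=\frac{1}{2l}\big[\nabla E(x+lv)-\nabla E(x-lv)\big]\qquad(l\neq0),$$ and at $l=0$ the function $H$ and its first-order partial derivatives are understood as the limits $l\to0$; in particular $H(x,v,0)=\nabla^2E(x)v$, $\partial_lH(x,v,0)=0$ and $\partial_vH(x,v,0)=\nabla^2E(x)$. A (non-degenerate) index-$k$ saddle point of $E$ is a point $x^*$ with $\nabla E(x^* )=0$ such that $\nabla^2E(x^* )$ is invertible and has exactly $k$ negative eigenvalues (counted with multiplicity). A steady state of the system is a point at which all right-hand sides vanish. It is linearly stable if all eigenvalues of the Jacobian matrix of the right-hand side with respect to $(x,m,v_1,\dots,v_k,l)$, evaluated at that point, have negative real parts. *)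

theory Defs
  imports "HOL-Analysis.Analysis"
begin

unbundle no fps_syntax

subsection \<open>Differentiability and derivatives of scalar functions\<close>

definition partial :: "'n \<Rightarrow> (real^'n \<Rightarrow> real) \<Rightarrow> real^'n \<Rightarrow> real" where
  "partial i f x = frechet_derivative f (at x) (axis i 1)"

text \<open>The class \<open>C\<^sup>r\<close> on the whole space: total differentiability is required at every stage, so the
  partial derivatives are meaningful, and all partial derivatives up to order \<open>r\<close> are continuous.\<close>

primrec C_class :: "nat \<Rightarrow> (real^'n \<Rightarrow> real) \<Rightarrow> bool" where
  "C_class 0 f \<longleftrightarrow> continuous_on UNIV f"
| "C_class (Suc r) f \<longleftrightarrow> f differentiable_on UNIV \<and> (\<forall>i. C_class r (partial i f))"

definition gradient :: "(real^'n \<Rightarrow> real) \<Rightarrow> real^'n \<Rightarrow> real^'n" where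
  "gradient f x = (\<chi> i. partial i f x)"

definition hessian :: "(real^'n \<Rightarrow> real) \<Rightarrow> real^'n \<Rightarrow> real^'n^'n" where
  "hessian f x = jacobian (gradient f) (at x)"


subsection \<open>Eigenvalues\<close>

definition eigenvalue :: "'a::field^'n^'n \<Rightarrow> 'a \<Rightarrow> bool" where
  "eigenvalue A \<mu> \<longleftrightarrow> (\<exists>z. z \<noteq> 0 \<and> A *v z = \<mu> *s z)"

definition charpoly :: "'a::comm_ring_1^'n^'n \<Rightarrow> 'a poly" where
  "charpoly A = det (mat [:0, 1:] - map_matrix (\<lambda>a. [:a:]) A)"

text \<open>Eigenvalues counted with algebraic multiplicity. For a real matrix these are only the
  real eigenvalues, which is no restriction for symmetric matrices.\<close>

definition eigenvalues :: "'a::field^'n^'n \<Rightarrow> 'a multiset" where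
  "eigenvalues A = proots (charpoly A)"

definition index_saddle :: "(real^'n \<Rightarrow> real) \<Rightarrow> nat \<Rightarrow> real^'n \<Rightarrow> bool" where
  "index_saddle E k x \<longleftrightarrow> gradient E x = 0 \<and> invertible (hessian E x) \<and>
     size (filter_mset (\<lambda>t. t < 0) (eigenvalues (hessian E x))) = k"


subsection \<open>The accelerated high-index saddle dynamics\<close>

definition outer :: "real^'n \<Rightarrow> real^'n \<Rightarrow> real^'n^'n" where
  "outer v w = (\<chi> i j. v $ i * w $ j)"

definition dimer_quotient :: "(real^'n \<Rightarrow> real) \<Rightarrow> real^'n \<Rightarrow> real^'n \<Rightarrow> real \<Rightarrow> real^'n" where
  "dimer_quotient E x v l =
     (1 / (2 * l)) *\<^sub>R (gradient E (x + l *\<^sub>R v) - gradient E (x - l *\<^sub>R v))"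

definition dimer :: "(real^'n \<Rightarrow> real) \<Rightarrow> real^'n \<Rightarrow> real^'n \<Rightarrow> real \<Rightarrow> real^'n" where
  "dimer E x v l = (if l = 0 then Lim (at 0) (dimer_quotient E x v) else dimer_quotient E x v l)"

text \<open>The direction variables \<open>v\<^sub>1, \<dots>, v\<^sub>k\<close> are indexed by an arbitrary finite linearly
  ordered type \<open>'k\<close> with \<open>k = CARD('k)\<close>; its elements are numbered increasingly by \<open>1, \<dots>, k\<close>.\<close>

definition number :: "'k::{finite,linorder} \<Rightarrow> nat" where
  "number i = card {..i}"

lemma strict_mono_number: "strict_mono number"
  unfolding number_def by (auto intro!: strict_monoI psubset_card_mono)

lemma bij_betw_number: "bij_betw number (UNIV :: 'k::{finite,linorder} set) {1..CARD('k)}"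
proof -
  have inj: "inj (number :: 'k \<Rightarrow> nat)"
    by (rule strict_mono_imp_inj_on[OF strict_mono_number])
  have "range (number :: 'k \<Rightarrow> nat) \<subseteq> {1..CARD('k)}"
    by (auto simp: number_def Suc_le_eq card_gt_0_iff intro!: card_mono)
  then have "range (number :: 'k \<Rightarrow> nat) = {1..CARD('k)}"
    by (intro card_subset_eq) (simp_all add: card_image[OF inj])
  with inj show ?thesis
    by (simp add: bij_betw_def)
qed

text \<open>Coordinates of the phase space with variables \<open>x, m, v\<^sub>1, \<dots>, v\<^sub>k, l\<close>, so that the Jacobian of
  the right-hand side is a square matrix of size \<open>(k + 2) d + 1\<close>.\<close>

datatype ('d, 'k) coord = X 'd | M 'd | V 'k 'd | L

instance coord :: (finite, finite) finite
proof
  have "(UNIV :: ('a, 'b) coord set) = range X \<union> range M \<union> range (\<lambda>(i, a). V i a) \<union> {L}"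
    by (auto simp: image_iff) (metis coord.exhaust)
  moreover have "finite (range X \<union> range M \<union> range (\<lambda>(i, a). V i a) \<union> {L} :: ('a, 'b) coord set)"
    by (intro finite_UnI finite_imageI) simp_all
  ultimately show "finite (UNIV :: ('a, 'b) coord set)"
    by metis
qed

definition state :: "real^'d \<Rightarrow> real^'d \<Rightarrow> ('k::finite \<Rightarrow> real^'d) \<Rightarrow> real \<Rightarrow> real^(('d, 'k) coord)" where
  "state x m v l = (\<chi> c. case c of X a \<Rightarrow> x $ a | M a \<Rightarrow> m $ a | V i a \<Rightarrow> v i $ a | L \<Rightarrow> l)"

definition ahisd_rhs :: "(real^'d \<Rightarrow> real) \<Rightarrow> real \<Rightarrow> real \<Rightarrow> real \<Rightarrow>
    real^(('d, 'k::{finite,linorder}) coord) \<Rightarrow> real^(('d, 'k) coord)" where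
  "ahisd_rhs E \<alpha>1 \<alpha>2 \<zeta> s =
    (let x = (\<chi> a. s $ X a); m = (\<chi> a. s $ M a); v = (\<lambda>i. \<chi> a. s $ V i a); l = s $ L in
     state m
       (- \<alpha>1 *\<^sub>R m - \<alpha>2 *\<^sub>R ((mat 1 - 2 *\<^sub>R (\<Sum>i\<in>UNIV. outer (v i) (v i))) *v gradient E x))
       (\<lambda>i. - \<zeta> *\<^sub>R ((mat 1 - outer (v i) (v i) - 2 *\<^sub>R (\<Sum>j\<in>{..<i}. outer (v j) (v j)))
                      *v dimer E x (v i) l))
       (- l))"

definition steady_state :: "(real^'n \<Rightarrow> real^'n) \<Rightarrow> real^'n \<Rightarrow> bool" where
  "steady_state F p \<longleftrightarrow> F p = 0"

definition linearly_stable :: "(real^'n \<Rightarrow> real^'n) \<Rightarrow> real^'n \<Rightarrow> bool" where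
  "linearly_stable F p \<longleftrightarrow>
     (\<forall>\<mu>. eigenvalue (map_matrix complex_of_real (jacobian F (at p))) \<mu> \<longrightarrow> Re \<mu> < 0)"

end

theory Submission
  imports Defs
begin

text \<open>Write \<open>A\<close> for the Hessian of \<open>E\<close> at \<open>x\<close> and \<open>\<mu>\<^sub>i = v\<^sub>i \<bullet> A v\<^sub>i\<close>.

  The steady state equations alone already force the directions to be orthonormal eigenvectors.
  They say \<open>l = m = 0\<close>, that \<open>I - 2 \<Sum>\<^sub>i v\<^sub>i v\<^sub>i\<^sup>T\<close> annihilates the gradient, and, because the dimer
  at \<open>l = 0\<close> is \<open>A v\<^sub>i\<close>, that \<open>A v\<^sub>i = \<mu>\<^sub>i v\<^sub>i + 2 \<Sum>\<^sub>j\<^sub><\<^sub>i (v\<^sub>j \<bullet> A v\<^sub>i) v\<^sub>j\<close>. Going through the directions in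
  order and pairing the last equation with \<open>v\<^sub>j\<close> and with \<open>v\<^sub>i\<close> shows that \<open>v\<^sub>i\<close> is orthogonal to its
  predecessors (\<open>stationary_directions_eigenframe\<close>). The matrix \<open>I - 2 \<Sum>\<^sub>i v\<^sub>i v\<^sub>i\<^sup>T\<close> is then a reflection,
  so the gradient vanishes.

  At such a point the right-hand side is differentiable even though \<open>l = 0\<close> is a removable
  singularity of the dimer: the difference quotient is symmetric in \<open>l\<close>, so its first-order
  dependence on \<open>l\<close> cancels (\<open>has_derivative_dimer\<close>). The derivative is block triangular for the
  order \<open>l\<close>, \<open>(x, m)\<close>, \<open>v\<^sub>1\<close>, \<dots>, \<open>v\<^sub>k\<close> of the unknowns, and every diagonal block is decoupled by an
  orthonormal eigenbasis \<open>u\<close> of \<open>A\<close> that contains the \<open>v\<^sub>i\<close>. The \<open>l\<close> block contributes \<open>-1\<close>. The \<open>(x, m)\<close>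
  block splits into damped oscillators \<open>\<rho>\<^sup>2 + \<alpha>1 \<rho> + \<alpha>2 \<kappa> = 0\<close>, where \<open>\<kappa>\<close> is minus the eigenvalue of \<open>u\<close> if
  \<open>u\<close> is one of the \<open>v\<^sub>i\<close>, and the eigenvalue itself otherwise. The block of \<open>v\<^sub>i\<close> contributes
  \<open>\<zeta> (\<mu>\<^sub>i + \<mu>\<^sub>j)\<close> for \<open>j \<le> i\<close> and \<open>\<zeta> (\<mu>\<^sub>i - \<nu>)\<close> for the eigenvalues \<open>\<nu>\<close> of all other \<open>u\<close>.

  If the \<open>v\<^sub>i\<close> belong to the \<open>k\<close> negative eigenvalues in increasing order, all these numbers have
  negative real part (\<open>stable_if_lowest\<close>). Conversely, two families of explicit real eigenvectors
  show that stability gives \<open>\<mu>\<^sub>i < 0\<close> and \<open>\<mu>\<^sub>i < \<mu>\<^sub>j\<close> for \<open>i < j\<close>; as \<open>A\<close> has exactly \<open>k\<close> negative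
  eigenvalues, the \<open>\<mu>\<^sub>i\<close> are these eigenvalues in increasing order.

  Eigenvalues with their multiplicities are accessible because an orthonormal eigenbasis \<open>B\<close> of \<open>A\<close>
  factors the characteristic polynomial (\<open>eigenvalues_orthonormal_eigenbasis\<close>): once the \<open>v\<^sub>i\<close> use
  up all negative eigenvalues, every other basis vector has a positive one.\<close>

section \<open>Orthonormal eigenbases and eigenvalues with multiplicity\<close>

lemma quadratic_nonpos_imp_linear_zero:
  fixes a b :: real
  assumes "\<And>t. 2 * t * a + t\<^sup>2 * b \<le> 0"
  shows "a = 0"
proof (rule ccontr)
  assume "a \<noteq> 0"
  \<comment> \<open>At \<open>t = a / c\<close> the linear term outweighs the quadratic one.\<close>
  define c where "c = \<bar>b\<bar> + 1"
  have "c > 0" "- b < c" by (auto simp: c_def)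
  have "2 * (a / c) * a + (a / c)\<^sup>2 * b = (a / c)\<^sup>2 * (2 * c + b)"
    using \<open>c > 0\<close> by (simp add: field_simps power2_eq_square)
  moreover have "(a / c)\<^sup>2 * (2 * c + b) > 0"
    using \<open>a \<noteq> 0\<close> \<open>c > 0\<close> \<open>- b < c\<close> by (intro mult_pos_pos) auto
  ultimately show False using assms[of "a / c"] by linarith
qed

text \<open>A maximiser \<open>u\<close> of the Rayleigh quotient on the unit sphere of \<open>S\<close> is an eigenvector: perturbing it to
  \<open>u + t w\<close> with \<open>w\<close> in \<open>S\<close> shows that \<open>f u - (u \<bullet> f u) u\<close> is orthogonal to every such \<open>w\<close>, and it lies in
  \<open>S\<close> itself.\<close>

lemma self_adjoint_eigenvector:
  fixes f :: "'a::euclidean_space \<Rightarrow> 'a"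
  assumes lin: "linear f" and adj: "\<And>x y. f x \<bullet> y = x \<bullet> f y"
    and S: "subspace S" and inv: "f ` S \<subseteq> S" and nz: "S \<noteq> {0}"
  obtains u where "u \<in> S" "norm u = 1" "f u = (u \<bullet> f u) *\<^sub>R u"
proof -
  define K where "K = S \<inter> sphere 0 1"
  obtain z where z: "z \<in> S" "z \<noteq> 0" using nz subspace_0[OF S] by auto
  have "(1 / norm z) *\<^sub>R z \<in> K"
    using z S by (auto simp: K_def subspace_scale)
  then have "K \<noteq> {}" by auto
  moreover have "compact K"
    unfolding K_def by (intro closed_Int_compact closed_subspace S compact_sphere)
  moreover have "continuous_on K (\<lambda>x. x \<bullet> f x)"
    by (intro continuous_intros linear_continuous_on linear_conv_bounded_linear[THEN iffD1] lin)
  ultimately obtain u where u: "u \<in> K" and max: "\<And>y. y \<in> K \<Longrightarrow> y \<bullet> f y \<le> u \<bullet> f u"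
    using continuous_attains_sup by metis
  define c where "c = u \<bullet> f u"
  have uS: "u \<in> S" and un: "norm u = 1" using u by (auto simp: K_def)
  have bound: "y \<bullet> f y \<le> c * (y \<bullet> y)" if "y \<in> S" for y
  proof (cases "y = 0")
    case False
    then have "(1 / norm y) *\<^sub>R y \<in> K"
      using that S by (auto simp: K_def subspace_scale)
    from max[OF this] have "(y \<bullet> f y) / (norm y)\<^sup>2 \<le> c"
      by (simp add: c_def linear_cmul[OF lin] power2_eq_square)
    then show ?thesis using False
      by (simp add: divide_simps power2_norm_eq_inner mult.commute)
  qed (simp add: linear_0[OF lin])
  have orth: "w \<bullet> (f u - c *\<^sub>R u) = 0" if w: "w \<in> S" for w
  proof (rule quadratic_nonpos_imp_linear_zero)
    fix t
    have "u + t *\<^sub>R w \<in> S" using w uS S by (simp add: subspace_add subspace_scale)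
    from bound[OF this]
    have "c + 2 * t * (w \<bullet> f u) + t\<^sup>2 * (w \<bullet> f w) \<le> c * (1 + 2 * t * (w \<bullet> u) + t\<^sup>2 * (w \<bullet> w))"
      using adj[of u w] un
      by (simp add: linear_add[OF lin] linear_cmul[OF lin] inner_add_left inner_add_right
          c_def[symmetric] power2_eq_square inner_commute algebra_simps norm_eq_1)
    then show "2 * t * (w \<bullet> (f u - c *\<^sub>R u)) + t\<^sup>2 * (w \<bullet> f w - c * (w \<bullet> w)) \<le> 0"
      by (simp add: algebra_simps inner_diff_right)
  qed
  have "f u - c *\<^sub>R u \<in> S" using uS inv S by (auto intro!: subspace_diff subspace_scale)
  from orth[OF this] have "f u = c *\<^sub>R u" by simp
  with uS un show thesis by (intro that) (auto simp: c_def)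
qed

text \<open>The eigenvalue of a unit eigenvector \<open>b\<close> is its Rayleigh quotient \<open>b \<bullet> f b\<close>, so no separate
  assignment of eigenvalues to vectors has to be carried along.\<close>

definition orthonormal_eigenvectors :: "('a::real_inner \<Rightarrow> 'a) \<Rightarrow> 'a set \<Rightarrow> bool" where
  "orthonormal_eigenvectors f B \<longleftrightarrow>
     pairwise orthogonal B \<and> (\<forall>b\<in>B. norm b = 1 \<and> f b = (b \<bullet> f b) *\<^sub>R b)"

text \<open>Induction on the dimension: the vectors of \<open>S\<close> orthogonal to one eigenvector in \<open>S\<close> form an
  invariant subspace of smaller dimension. Working in an arbitrary invariant subspace, instead of
  the whole space, is what allows a given orthonormal family to be completed.\<close>

theorem spectral_theorem_subspace:
  fixes f :: "'a::euclidean_space \<Rightarrow> 'a"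
  assumes lin: "linear f" and adj: "\<And>x y. f x \<bullet> y = x \<bullet> f y"
  shows "subspace S \<Longrightarrow> f ` S \<subseteq> S \<Longrightarrow> \<exists>B. orthonormal_eigenvectors f B \<and> span B = S"
proof (induction "dim S" arbitrary: S rule: less_induct)
  case (less S)
  show ?case
  proof (cases "S = {0}")
    case True
    then show ?thesis by (intro exI[of _ "{}"]) (auto simp: orthonormal_eigenvectors_def)
  next
    case False
    obtain u where u: "u \<in> S" "norm u = 1" "f u = (u \<bullet> f u) *\<^sub>R u"
      using self_adjoint_eigenvector[OF lin adj less.prems False] by blast
    define T where "T = S \<inter> {y. orthogonal u y}"
    have T: "subspace T"
      unfolding T_def by (intro subspace_inter less.prems subspace_orthogonal_to_vector)
    have "u \<notin> T" using u by (auto simp: T_def orthogonal_self)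
    then have "dim T < dim S"
      using u less.prems T by (intro dim_psubset) (auto simp: T_def span_eq_iff[THEN iffD2])
    moreover have "f ` T \<subseteq> T"
    proof safe
      fix y assume y: "y \<in> T"
      have "u \<bullet> f y = (u \<bullet> f u) * (u \<bullet> y)"
        by (metis adj u(3) inner_scaleR_left)
      with y less.prems show "f y \<in> T" by (auto simp: T_def orthogonal_def)
    qed
    ultimately obtain B where B: "orthonormal_eigenvectors f B" "span B = T"
      using less.hyps T by blast
    then have BT: "B \<subseteq> T" using span_superset by blast
    have "orthonormal_eigenvectors f (insert u B)"
      using B(1) u BT
      by (auto simp: orthonormal_eigenvectors_def pairwise_insert T_def orthogonal_commute)
    moreover have "span (insert u B) = S"
    proof
      show "span (insert u B) \<subseteq> S"
        using u BT by (intro span_minimal less.prems) (auto simp: T_def)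
      show "S \<subseteq> span (insert u B)"
      proof
        fix y assume "y \<in> S"
        then have "y - (u \<bullet> y) *\<^sub>R u \<in> T"
          using u less.prems
          by (auto simp: T_def orthogonal_def inner_diff_right norm_eq_1
              intro!: subspace_diff subspace_scale)
        then have "y - (u \<bullet> y) *\<^sub>R u \<in> span B" using B by simp
        then show "y \<in> span (insert u B)"
          by (auto simp: span_insert)
      qed
    qed
    ultimately show ?thesis by blast
  qed
qed

text \<open>The orthogonal complement of a set of eigenvectors is invariant, so it has an eigenbasis of its own.\<close>

lemma orthonormal_eigenbasis_extension:
  fixes f :: "'a::euclidean_space \<Rightarrow> 'a"
  assumes lin: "linear f" and adj: "\<And>x y. f x \<bullet> y = x \<bullet> f y"
    and W: "orthonormal_eigenvectors f W"
  obtains B where "W \<subseteq> B" "orthonormal_eigenvectors f B" "span B = UNIV"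
proof -
  define S where "S = {y. \<forall>x\<in>W. orthogonal x y}"
  have S: "subspace S" unfolding S_def by (rule subspace_orthogonal_to_vectors)
  have "f ` S \<subseteq> S"
  proof safe
    fix y assume y: "y \<in> S"
    have "w \<bullet> f y = 0" if "w \<in> W" for w
    proof -
      have "w \<bullet> f y = f w \<bullet> y" by (simp add: adj)
      also have "\<dots> = (w \<bullet> f w) * (w \<bullet> y)"
        using W that by (metis orthonormal_eigenvectors_def inner_scaleR_left)
      also have "\<dots> = 0" using y that by (simp add: S_def orthogonal_def)
      finally show ?thesis .
    qed
    then show "f y \<in> S" by (simp add: S_def orthogonal_def)
  qed
  with spectral_theorem_subspace[OF lin adj S] obtain B
    where B: "orthonormal_eigenvectors f B" "span B = S" by blast
  then have BS: "B \<subseteq> S" using span_superset by blast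
  show thesis
  proof
    show "W \<subseteq> W \<union> B" by simp
    have "orthogonal w b" "orthogonal b w" if "w \<in> W" "b \<in> B" for w b
      using that BS by (auto simp: S_def orthogonal_commute[of b])
    then show "orthonormal_eigenvectors f (W \<union> B)"
      using W B(1) unfolding orthonormal_eigenvectors_def pairwise_def by blast
    have "y \<in> span (W \<union> B)" for y
    proof -
      obtain a b where "a \<in> span W" "\<And>w. w \<in> span W \<Longrightarrow> orthogonal b w" "y = a + b"
        using orthogonal_subspace_decomp_exists[of W y] by metis
      moreover have "b \<in> span B"
        unfolding B S_def using calculation by (auto simp: span_base orthogonal_commute)
      ultimately show ?thesis
        by (metis span_add span_mono in_mono sup_ge1 sup_ge2)
    qed
    then show "span (W \<union> B) = UNIV" by auto
  qed
qed

lemma det_map_matrix_const_poly: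
  "det (map_matrix (\<lambda>a. [:a:]) (A :: real^'n^'n)) = [:det A:]"
  by (simp add: det_def sum_to_poly prod_to_poly of_int_poly mult.commute)

text \<open>Let \<open>Q\<close> have the basis vectors as columns and let \<open>D\<close> be the diagonal matrix with the entries \<open>X - \<nu>\<^sub>j\<close>.
  Then \<open>(X I - A) Q = Q D\<close> over the polynomials. Since \<open>det Q\<close> is a nonzero constant, the
  characteristic polynomial is \<open>det D\<close>, a product of linear factors. In particular the algebraic
  multiplicity of an eigenvalue counts the basis vectors that belong to it.\<close>

lemma eigenvalues_orthonormal_eigenbasis:
  fixes A :: "real^'n^'n"
  assumes B: "orthonormal_eigenvectors ((*v) A) B" and sp: "span B = UNIV"
  shows "eigenvalues A = image_mset (\<lambda>b. b \<bullet> (A *v b)) (mset_set B)"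
proof -
  have orth: "pairwise orthogonal B" and nrm: "\<And>b. b \<in> B \<Longrightarrow> norm b = 1"
    and eig: "\<And>b. b \<in> B \<Longrightarrow> A *v b = (b \<bullet> (A *v b)) *\<^sub>R b"
    using B by (auto simp: orthonormal_eigenvectors_def)
  have ind: "independent B"
    using orth nrm by (intro pairwise_orthogonal_independent) force+
  have "card B = CARD('n)"
    using ind sp dim_span[of B] dim_eq_card_independent[OF ind] by simp
  moreover have "finite B" using ind by (rule independent_imp_finite)
  ultimately obtain h :: "'n \<Rightarrow> real^'n" where h: "bij_betw h UNIV B"
    by (metis finite_same_card_bij finite_class.finite_UNIV)
  have hB: "h j \<in> B" for j using h by (auto simp: bij_betw_def)
  define \<nu> where "\<nu> = (\<lambda>j. h j \<bullet> (A *v h j))"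
  define Q where "Q = (\<chi> i j. h j $ i)"
  define P where "P = map_matrix (\<lambda>a::real. [:a:]) Q"
  define D where "D = (\<chi> i j. if i = j then [:- \<nu> j, 1:] else 0)"
  have "transpose Q ** Q = mat 1"
  proof -
    have "(\<Sum>a\<in>UNIV. h i $ a * h j $ a) = (if i = j then 1 else 0)" for i j
    proof -
      have "h i \<bullet> h j = (if i = j then 1 else 0)"
      proof (cases "i = j")
        case False
        then have "h i \<noteq> h j" using h by (auto simp: bij_betw_def inj_def)
        with orth hB show ?thesis using False by (auto simp: pairwise_def orthogonal_def)
      qed (use nrm[OF hB] in \<open>simp add: norm_eq_1\<close>)
      then show ?thesis by (simp add: inner_vec_def)
    qed
    then show ?thesis
      by (simp add: vec_eq_iff matrix_matrix_mult_def transpose_def Q_def mat_def)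
  qed
  then have "det Q \<noteq> 0"
    by (metis det_I det_mul mult_zero_right zero_neq_one)
  then have Pnz: "det P \<noteq> 0" by (simp add: P_def det_map_matrix_const_poly)
  have AQ: "(\<Sum>k\<in>UNIV. A $ i $ k * h j $ k) = \<nu> j * h j $ i" for i j
    using arg_cong[OF eig[OF hB], of "\<lambda>v. v $ i"]
    by (simp add: matrix_vector_mult_def \<nu>_def)
  have "(mat [:0, 1:] - map_matrix (\<lambda>a. [:a:]) A) ** P = P ** D"
  proof -
    have "(\<Sum>k\<in>UNIV. ((if i = k then [:0, 1:] else 0) - [:A $ i $ k:]) * [:h j $ k:])
        = (\<Sum>k\<in>UNIV. [:h k $ i:] * (if k = j then [:- \<nu> j, 1:] else 0))" (is "?l = ?r") for i j
    proof -
      have "?l = (\<Sum>k\<in>UNIV. (if i = k then [:0, 1:] * [:h j $ k:] else 0)) - (\<Sum>k\<in>UNIV. [:A $ i $ k * h j $ k:])"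
        unfolding sum_subtractf[symmetric] by (intro sum.cong refl) (simp add: left_diff_distrib)
      also have "\<dots> = [:0, 1:] * [:h j $ i:] - [:\<nu> j * h j $ i:]"
        by (simp only: sum_to_poly AQ sum.delta' sum.delta finite UNIV_I if_True)
      also have "\<dots> = ?r" by (simp add: if_distrib cong: if_cong)
      finally show ?thesis .
    qed
    then show ?thesis
      by (simp add: vec_eq_iff matrix_matrix_mult_def P_def D_def Q_def mat_def)
  qed
  from arg_cong[OF this, of det] have "charpoly A * det P = det P * det D"
    by (simp add: det_mul charpoly_def)
  then have "charpoly A = det D" using Pnz by simp
  also have "\<dots> = (\<Prod>j\<in>UNIV. [:- \<nu> j, 1:])"
    by (subst det_diagonal) (auto simp: D_def)
  finally have "eigenvalues A = (\<Sum>j\<in>UNIV. {#\<nu> j#})"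
    by (simp add: eigenvalues_def proots_prod)
  also have "\<dots> = image_mset \<nu> (mset_set UNIV)"
    by (simp add: sum_unfold_sum_mset)
  also have "\<dots> = image_mset (\<lambda>b. b \<bullet> (A *v b)) (mset_set B)"
  proof -
    have "mset_set B = image_mset h (mset_set UNIV)"
      using h by (metis bij_betw_def image_mset_mset_set)
    then show ?thesis by (simp add: \<nu>_def image_mset.compositionality o_def)
  qed
  finally show ?thesis .
qed

section \<open>Gradient and Hessian\<close>

lemma has_derivative_vecI:
  fixes f :: "'a::real_normed_vector \<Rightarrow> real^'n"
  assumes "\<And>i. ((\<lambda>x. f x $ i) has_derivative (\<lambda>h. f' h $ i)) (at x within S)"
  shows "(f has_derivative f') (at x within S)"
  by (subst has_derivative_componentwise_within)
    (use assms in \<open>auto simp: Basis_vec_def inner_axis\<close>)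

lemma partial_eqI:
  assumes "(f has_derivative f') (at x)"
  shows "partial i f x = f' (axis i 1)"
  using frechet_derivative_at[OF assms] by (simp add: partial_def)

lemma has_derivative_gradient:
  fixes f :: "real^'n \<Rightarrow> real"
  assumes "f differentiable (at x)"
  shows "(f has_derivative (\<lambda>h. gradient f x \<bullet> h)) (at x)"
proof -
  define f' where "f' = frechet_derivative f (at x)"
  have f': "(f has_derivative f') (at x)"
    using assms by (simp add: f'_def frechet_derivative_works)
  then have "linear f'" by (rule has_derivative_linear)
  have "f' = (\<lambda>h. gradient f x \<bullet> h)"
  proof
    fix h :: "real^'n"
    have "h = (\<Sum>i\<in>UNIV. h $ i *\<^sub>R axis i 1)"
      using basis_expansion[of h] by (simp add: scalar_mult_eq_scaleR)
    then have "f' h = f' (\<Sum>i\<in>UNIV. h $ i *\<^sub>R axis i 1)" by simp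
    also have "\<dots> = (\<Sum>i\<in>UNIV. h $ i * partial i f x)"
      using \<open>linear f'\<close> by (simp add: linear_sum linear_cmul partial_def f'_def)
    finally show "f' h = gradient f x \<bullet> h" by (simp add: inner_vec_def gradient_def mult.commute)
  qed
  with f' show ?thesis by simp
qed

lemma has_real_derivative_along_line:
  fixes f :: "real^'n \<Rightarrow> real"
  assumes "f differentiable (at (y + t *\<^sub>R v))"
  shows "((\<lambda>t. f (y + t *\<^sub>R v)) has_real_derivative gradient f (y + t *\<^sub>R v) \<bullet> v) (at t)"
proof -
  have "((\<lambda>t. y + t *\<^sub>R v) has_derivative (\<lambda>t. t *\<^sub>R v)) (at t)"
    by (auto intro!: derivative_eq_intros)
  from has_derivative_compose[OF this has_derivative_gradient[OF assms]]
  show ?thesis by (simp add: has_field_derivative_def mult.commute[of _ "_ \<bullet> _"])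
qed

lemma gradient_axis: "gradient f x \<bullet> axis i 1 = partial i f x"
  by (simp add: gradient_def inner_axis)

lemma has_derivative_gradient_hessian:
  assumes "\<And>a. partial a f differentiable (at x)"
  shows "(gradient f has_derivative (*v) (hessian f x)) (at x)"
proof -
  have "(gradient f has_derivative (\<lambda>h. \<chi> a. gradient (partial a f) x \<bullet> h)) (at x)"
    by (rule has_derivative_vecI) (simp add: gradient_def[of f] has_derivative_gradient assms)
  then have "gradient f differentiable (at x)" by (rule differentiableI)
  then show ?thesis by (simp add: hessian_def flip: jacobian_works)
qed

lemma hessian_row:
  assumes "\<And>a. partial a f differentiable (at x)"
  shows "hessian f x $ a = gradient (partial a f) x"
proof -
  have "((\<lambda>y. gradient f y $ a) has_derivative (\<lambda>h. (hessian f x *v h) $ a)) (at x)"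
    by (intro bounded_linear.has_derivative[OF bounded_linear_vec_nth] has_derivative_gradient_hessian assms)
  then have "(partial a f has_derivative (\<lambda>h. (hessian f x *v h) $ a)) (at x)"
    by (simp add: gradient_def)
  then show ?thesis
    by (simp add: vec_eq_iff gradient_def partial_eqI matrix_vector_mult_basis column_def)
qed

text \<open>Two applications of the mean value theorem, first in direction \<open>i\<close> and then in direction \<open>j\<close>. The
  second difference on the left does not depend on the order of the two directions.\<close>

lemma second_difference_mean_value:
  fixes f :: "real^'n \<Rightarrow> real"
  assumes f: "\<And>y. f differentiable (at y)" and fi: "\<And>y. partial i f differentiable (at y)"
    and h: "h > 0"
  obtains y where "norm (y - x) \<le> 2 * h"
    "f (x + h *\<^sub>R axis i 1 + h *\<^sub>R axis j 1) - f (x + h *\<^sub>R axis i 1) - f (x + h *\<^sub>R axis j 1) + f x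
      = h * h * partial j (partial i f) y"
proof -
  let ?u = "axis i 1 :: real^'n" and ?w = "axis j 1 :: real^'n"
  define \<phi> where "\<phi> t = f (x + h *\<^sub>R ?w + t *\<^sub>R ?u) - f (x + t *\<^sub>R ?u)" for t
  have "(\<phi> has_real_derivative
      (partial i f (x + h *\<^sub>R ?w + t *\<^sub>R ?u) - partial i f (x + t *\<^sub>R ?u))) (at t)" for t
    unfolding \<phi>_def gradient_axis[symmetric]
    by (intro DERIV_diff has_real_derivative_along_line f)
  from MVT2[OF h this] obtain s where s: "0 < s" "s < h"
    and 1: "\<phi> h - \<phi> 0 = h * (partial i f (x + h *\<^sub>R ?w + s *\<^sub>R ?u) - partial i f (x + s *\<^sub>R ?u))"
    by auto
  have "((\<lambda>t. partial i f (x + s *\<^sub>R ?u + t *\<^sub>R ?w)) has_real_derivative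
      partial j (partial i f) (x + s *\<^sub>R ?u + t *\<^sub>R ?w)) (at t)" for t
    unfolding gradient_axis[symmetric] by (intro has_real_derivative_along_line fi[unfolded gradient_axis[symmetric]])
  from MVT2[OF h this] obtain r where r: "0 < r" "r < h"
    and 2: "partial i f (x + s *\<^sub>R ?u + h *\<^sub>R ?w) - partial i f (x + s *\<^sub>R ?u)
      = h * partial j (partial i f) (x + s *\<^sub>R ?u + r *\<^sub>R ?w)"
    by auto
  show thesis
  proof (rule that[of "x + s *\<^sub>R ?u + r *\<^sub>R ?w"])
    have "norm (s *\<^sub>R ?u + r *\<^sub>R ?w) \<le> s + r"
      using s r norm_triangle_ineq[of "s *\<^sub>R ?u" "r *\<^sub>R ?w"] by simp
    then show "norm (x + s *\<^sub>R ?u + r *\<^sub>R ?w - x) \<le> 2 * h" using s r by (simp add: add.assoc)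
    show "f (x + h *\<^sub>R ?u + h *\<^sub>R ?w) - f (x + h *\<^sub>R ?u) - f (x + h *\<^sub>R ?w) + f x
      = h * h * partial j (partial i f) (x + s *\<^sub>R ?u + r *\<^sub>R ?w)"
      using 1 2 by (simp add: \<phi>_def add.assoc add.commute[of "_ *\<^sub>R ?w"])
  qed
qed

text \<open>On ever smaller squares, both mixed partial derivatives take the value of the same second
  difference quotient at some point near \<open>x\<close>; continuity then identifies their values at \<open>x\<close>.\<close>

lemma mixed_partials_commute:
  fixes f :: "real^'n \<Rightarrow> real"
  assumes f: "\<And>y. f differentiable (at y)" and f1: "\<And>a y. partial a f differentiable (at y)"
    and f2: "\<And>a b. isCont (partial a (partial b f)) x"
  shows "partial j (partial i f) x = partial i (partial j f) x"
proof -
  define h where "h n = inverse (real (Suc n))" for n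
  have h: "h n > 0" for n by (simp add: h_def)
  have h0: "(\<lambda>n. 2 * h n) \<longlonglongrightarrow> 0"
    unfolding h_def by (rule tendsto_mult_right_zero[OF LIMSEQ_inverse_real_of_nat])
  have "\<exists>y z. norm (y - x) \<le> 2 * h n \<and> norm (z - x) \<le> 2 * h n \<and>
      partial j (partial i f) y = partial i (partial j f) z" for n
  proof -
    obtain y where y: "norm (y - x) \<le> 2 * h n" "f (x + h n *\<^sub>R axis i 1 + h n *\<^sub>R axis j 1)
        - f (x + h n *\<^sub>R axis i 1) - f (x + h n *\<^sub>R axis j 1) + f x = h n * h n * partial j (partial i f) y"
      using second_difference_mean_value[OF f f1 h] by blast
    obtain z where z: "norm (z - x) \<le> 2 * h n" "f (x + h n *\<^sub>R axis j 1 + h n *\<^sub>R axis i 1)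
        - f (x + h n *\<^sub>R axis j 1) - f (x + h n *\<^sub>R axis i 1) + f x = h n * h n * partial i (partial j f) z"
      using second_difference_mean_value[OF f f1 h] by blast
    have "h n * h n * partial j (partial i f) y = h n * h n * partial i (partial j f) z"
      unfolding y(2)[symmetric] z(2)[symmetric] by (simp add: algebra_simps)
    then show ?thesis using y z h[of n] by auto
  qed
  then obtain y z where yz: "\<And>n. norm (y n - x) \<le> 2 * h n" "\<And>n. norm (z n - x) \<le> 2 * h n"
    "\<And>n. partial j (partial i f) (y n) = partial i (partial j f) (z n)" by metis
  have "y \<longlonglongrightarrow> x" "z \<longlonglongrightarrow> x"
    using yz(1,2) by (auto intro!: LIM_zero_cancel[of _ x] Lim_null_comparison[OF _ h0] eventuallyI)
  then have "(\<lambda>n. partial j (partial i f) (y n)) \<longlonglongrightarrow> partial j (partial i f) x"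
    "(\<lambda>n. partial i (partial j f) (z n)) \<longlonglongrightarrow> partial i (partial j f) x"
    using f2 by (auto intro: isCont_tendsto_compose)
  with yz(3) show ?thesis using LIMSEQ_unique by simp
qed

lemma hessian_symmetric:
  fixes f :: "real^'n \<Rightarrow> real"
  assumes "\<And>y. f differentiable (at y)" and "\<And>a y. partial a f differentiable (at y)"
    and "\<And>a b. isCont (partial a (partial b f)) x"
  shows "transpose (hessian f x) = hessian f x"
  using mixed_partials_commute[OF assms]
  by (simp add: vec_eq_iff transpose_def hessian_row assms gradient_def)

section \<open>The dimer at vanishing length\<close>

lemma dimer_zero:
  assumes "\<And>a. partial a E differentiable (at x)"
  shows "dimer E x v 0 = hessian E x *v v"
proof -
  have *: "(gradient E has_derivative (*v) (hessian E x)) (at (x + 0 *\<^sub>R w))" for w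
    using has_derivative_gradient_hessian[OF assms] by simp
  have "((\<lambda>t. x + t *\<^sub>R w) has_derivative (\<lambda>t. t *\<^sub>R w)) (at 0)" for w
    by (auto intro!: derivative_eq_intros)
  from has_derivative_compose[OF this *]
  have "((\<lambda>t. gradient E (x + t *\<^sub>R w)) has_vector_derivative (hessian E x *v w)) (at 0)" for w
    by (simp add: has_vector_derivative_def matrix_vector_mult_scaleR)
  from has_vector_derivative_diff[OF this[of v] this[of "-v"]]
  have "((\<lambda>t. gradient E (x + t *\<^sub>R v) - gradient E (x - t *\<^sub>R v)) has_vector_derivative
      2 *\<^sub>R (hessian E x *v v)) (at 0)"
    by (simp add: linear_neg scaleR_2)
  then have lim: "((\<lambda>t. norm ((1 / \<bar>t\<bar>) *\<^sub>R (gradient E (x + t *\<^sub>R v) - gradient E (x - t *\<^sub>R v)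
      - t *\<^sub>R 2 *\<^sub>R (hessian E x *v v)))) \<longlongrightarrow> 0) (at 0)"
    by (intro tendsto_norm_zero) (simp add: has_vector_derivative_def has_derivative_def divide_inverse)
  have scale: "norm ((1 / \<bar>t\<bar>) *\<^sub>R (w - t *\<^sub>R z)) = norm ((1 / t) *\<^sub>R w - z)" if "t \<noteq> 0"
    for t and w z :: "real^'n"
  proof -
    have "norm ((1 / \<bar>t\<bar>) *\<^sub>R (w - t *\<^sub>R z)) = norm ((1 / t) *\<^sub>R (w - t *\<^sub>R z))" by simp
    then show ?thesis using that by (simp only: scaleR_diff_right scaleR_scaleR) simp
  qed
  have "\<forall>\<^sub>F t in at (0::real). t \<noteq> 0" by (simp add: eventually_at_filter)
  then have "\<forall>\<^sub>F t in at 0. norm ((1 / \<bar>t\<bar>) *\<^sub>R (gradient E (x + t *\<^sub>R v) - gradient E (x - t *\<^sub>R v)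
        - t *\<^sub>R 2 *\<^sub>R (hessian E x *v v))) =
      norm ((1 / t) *\<^sub>R (gradient E (x + t *\<^sub>R v) - gradient E (x - t *\<^sub>R v)) - 2 *\<^sub>R (hessian E x *v v))"
    by (rule eventually_mono) (rule scale)
  from lim this have "((\<lambda>t. norm ((1 / t) *\<^sub>R (gradient E (x + t *\<^sub>R v) - gradient E (x - t *\<^sub>R v))
      - 2 *\<^sub>R (hessian E x *v v))) \<longlongrightarrow> 0) (at 0)"
    by (rule Lim_transform_eventually)
  then have "((\<lambda>t. (1 / t) *\<^sub>R (gradient E (x + t *\<^sub>R v) - gradient E (x - t *\<^sub>R v))) \<longlongrightarrow>
      2 *\<^sub>R (hessian E x *v v)) (at 0)"
    by (rule LIM_zero_cancel[OF tendsto_norm_zero_cancel])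
  from tendsto_scaleR[OF tendsto_const this, of "1/2"]
  have "(dimer_quotient E x v \<longlongrightarrow> hessian E x *v v) (at 0)"
    by (simp add: dimer_quotient_def[abs_def])
  then show ?thesis unfolding dimer_def by (simp add: tendsto_Lim)
qed

text \<open>The mean value theorem is applied to the odd function \<open>t \<mapsto> g (x + t v) - g (x - t v)\<close> with
  \<open>g\<close> the component \<open>a\<close> of the gradient, rather than to \<open>t \<mapsto> g (x + t v)\<close> on the interval from \<open>-l\<close> to
  \<open>l\<close>. This gives a mean over two points symmetric about \<open>x\<close>, whose displacements cancel to first order.\<close>

lemma dimer_mean_value:
  fixes E :: "real^'n \<Rightarrow> real"
  assumes E2: "\<And>a y. partial a E differentiable (at y)"
  obtains \<tau> where "\<bar>\<tau>\<bar> \<le> \<bar>l\<bar>"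
    "dimer E x v l $ a = (1/2) *\<^sub>R (hessian E (x + \<tau> *\<^sub>R v) $ a + hessian E (x - \<tau> *\<^sub>R v) $ a) \<bullet> v"
proof (cases "l = 0")
  case True
  show thesis
    by (rule that[of 0]) (simp_all add: True dimer_zero assms matrix_vector_mult_def inner_vec_def)
next
  case False
  then have l: "\<bar>l\<bar> > 0" by simp
  let ?G = "gradient (partial a E)"
  define \<phi> where "\<phi> t = partial a E (x + t *\<^sub>R v) - partial a E (x - t *\<^sub>R v)" for t
  have "(\<phi> has_real_derivative (?G (x + t *\<^sub>R v) + ?G (x - t *\<^sub>R v)) \<bullet> v) (at t)" for t
    using DERIV_diff[OF has_real_derivative_along_line[of "partial a E" x t v, OF E2]
        has_real_derivative_along_line[of "partial a E" x t "-v", OF E2]]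
    by (simp add: \<phi>_def[abs_def] inner_add_left)
  from MVT2[OF l this] obtain \<tau> where \<tau>: "0 < \<tau>" "\<tau> < \<bar>l\<bar>"
    "\<phi> \<bar>l\<bar> - \<phi> 0 = \<bar>l\<bar> * ((?G (x + \<tau> *\<^sub>R v) + ?G (x - \<tau> *\<^sub>R v)) \<bullet> v)" by auto
  have "dimer E x v l $ a = \<phi> \<bar>l\<bar> / (2 * \<bar>l\<bar>)"
    using False by (auto simp: dimer_def dimer_quotient_def \<phi>_def gradient_def abs_if field_simps)
  also have "\<phi> 0 = 0" by (simp add: \<phi>_def)
  with \<tau>(3) have "\<phi> \<bar>l\<bar> / (2 * \<bar>l\<bar>) = (1/2) * ((?G (x + \<tau> *\<^sub>R v) + ?G (x - \<tau> *\<^sub>R v)) \<bullet> v)"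
    using l by simp
  finally show thesis using \<tau> E2 by (intro that[of \<tau>]) (simp_all add: hessian_row)
qed

text \<open>The intermediate \<open>\<tau>\<close> is an unknown, possibly discontinuous function of the position, but it is at
  most \<open>\<bar>l\<bar>\<close> in size and enters through the two points \<open>y \<plusminus> \<tau> w\<close> only. Expanding the row \<open>a\<close> of the
  Hessian at \<open>x\<close> to first order at these points, the contributions of \<open>\<plusminus> \<tau> w\<close> cancel, so the mean of
  the two rows is differentiable and its derivative involves the displacement of the position only.
  As \<open>T\<close> will stand below the diagonal blocks of the linearization, its linearity is all that is recorded.\<close>

lemma has_derivative_dimer:
  fixes E :: "real^'n \<Rightarrow> real"
  assumes E2: "\<And>a y. partial a E differentiable (at y)"
    and E3: "\<And>a b. partial b (partial a E) differentiable (at x)"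
  obtains T where "linear T" "((\<lambda>(y, w, l). dimer E y w l) has_derivative
    (\<lambda>(y, w, l). T y + hessian E x *v w)) (at (x, v, 0))"
proof -
  have row: "((\<lambda>y. hessian E y $ a) has_derivative (\<lambda>h. hessian (partial a E) x *v h)) (at x)" for a
    using has_derivative_gradient_hessian[OF E3] by (simp add: hessian_row[OF E2])
  define T where "T h = (\<chi> a. (hessian (partial a E) x *v h) \<bullet> v)" for h
  have "((\<lambda>p. dimer E (fst p) (fst (snd p)) (snd (snd p)) $ a) has_derivative
      (\<lambda>p. (T (fst p) + hessian E x *v fst (snd p)) $ a)) (at (x, v, 0))" for a
  proof -
    let ?D = "\<lambda>h. hessian (partial a E) x *v h"
    obtain \<tau> where \<tau>: "\<And>p. \<bar>\<tau> p\<bar> \<le> \<bar>snd (snd p)\<bar>"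
      "\<And>p. dimer E (fst p) (fst (snd p)) (snd (snd p)) $ a =
        (1/2) *\<^sub>R (hessian E (fst p + \<tau> p *\<^sub>R fst (snd p)) $ a
                  + hessian E (fst p - \<tau> p *\<^sub>R fst (snd p)) $ a) \<bullet> fst (snd p)"
    proof -
      have "\<exists>\<tau>. \<bar>\<tau>\<bar> \<le> \<bar>snd (snd p)\<bar> \<and> dimer E (fst p) (fst (snd p)) (snd (snd p)) $ a =
        (1/2) *\<^sub>R (hessian E (fst p + \<tau> *\<^sub>R fst (snd p)) $ a
                  + hessian E (fst p - \<tau> *\<^sub>R fst (snd p)) $ a) \<bullet> fst (snd p)" for p
        by (rule dimer_mean_value[OF E2]) blast
      then have "\<forall>p. \<exists>\<tau>. \<bar>\<tau>\<bar> \<le> \<bar>snd (snd p)\<bar> \<and> dimer E (fst p) (fst (snd p)) (snd (snd p)) $ a =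
        (1/2) *\<^sub>R (hessian E (fst p + \<tau> *\<^sub>R fst (snd p)) $ a
                  + hessian E (fst p - \<tau> *\<^sub>R fst (snd p)) $ a) \<bullet> fst (snd p)" by blast
      from choice[OF this] show thesis using that by blast
    qed
    define K where "K p = (1/2) *\<^sub>R (hessian E (fst p + \<tau> p *\<^sub>R fst (snd p)) $ a
                  + hessian E (fst p - \<tau> p *\<^sub>R fst (snd p)) $ a)" for p
    have \<tau>0: "\<tau> (x, v, 0) = 0" using \<tau>(1)[of "(x, v, 0)"] by simp
    have K0: "K (x, v, 0) = hessian E x $ a" by (simp add: K_def \<tau>0)
    have "(K has_derivative (\<lambda>p. ?D (fst p))) (at (x, v, 0))"
      unfolding has_derivative_at_alt
    proof safe
      show "bounded_linear (\<lambda>p :: (real^'n) \<times> (real^'n) \<times> real. ?D (fst p))"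
        by (intro bounded_linear_compose[OF matrix_vector_mul_bounded_linear bounded_linear_fst])
      fix e :: real assume e: "e > 0"
      \<comment> \<open>At distance \<open>N < 1\<close> from \<open>(x, v, 0)\<close> the points \<open>y \<plusminus> \<tau> w\<close> are within \<open>N + N (norm v + 1) = N C\<close> of \<open>x\<close>.\<close>
      define C where "C = 2 + norm v"
      have C: "C > 0" by (simp add: C_def add_pos_nonneg)
      from row[of a, unfolded has_derivative_at_alt] e C obtain d where d: "d > 0"
        and bnd: "\<And>y. norm (y - x) < d \<Longrightarrow>
          norm (hessian E y $ a - hessian E x $ a - ?D (y - x)) \<le> e / C * norm (y - x)"
        by (meson divide_pos_pos)
      show "\<exists>d>0. \<forall>p. norm (p - (x, v, 0)) < d \<longrightarrow>
          norm (K p - K (x, v, 0) - ?D (fst (p - (x, v, 0)))) \<le> e * norm (p - (x, v, 0))"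
      proof (intro exI[of _ "min 1 (d / C)"] conjI allI impI)
        show "min 1 (d / C) > 0" using d C by simp
        fix p :: "(real^'n) \<times> (real^'n) \<times> real"
        assume p: "norm (p - (x, v, 0)) < min 1 (d / C)"
        define N where "N = norm (p - (x, v, 0))"
        obtain y w l where pe: "p = (y, w, l)" by (cases p) auto
        have N: "norm (y - x) \<le> N" "norm (w - v) \<le> N" "\<bar>l\<bar> \<le> N" "N \<ge> 0" "N < 1" "N * C < d"
          using p C norm_fst_le[of "y - x" "(w - v, l)"] norm_snd_le[of "(w - v, l)" "y - x"]
            norm_fst_le[of "w - v" l] norm_snd_le[of l "w - v"]
          by (auto simp: N_def pe field_simps)
        have near: "norm (y + s *\<^sub>R w - x) \<le> N * C" if "\<bar>s\<bar> \<le> \<bar>l\<bar>" for s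
        proof -
          have "norm w \<le> norm v + 1"
            using N norm_triangle_ineq[of v "w - v"] by simp
          then have "\<bar>s\<bar> * norm w \<le> N * (norm v + 1)" using that N by (intro mult_mono) auto
          moreover have "norm (y + s *\<^sub>R w - x) \<le> norm (y - x) + \<bar>s\<bar> * norm w"
            using norm_triangle_ineq[of "y - x" "s *\<^sub>R w"] by (simp add: algebra_simps)
          ultimately show ?thesis using N by (simp add: C_def algebra_simps)
        qed
        define r where "r s = hessian E (y + s *\<^sub>R w) $ a - hessian E x $ a - ?D (y + s *\<^sub>R w - x)" for s
        have r: "norm (r s) \<le> e * N" if "\<bar>s\<bar> \<le> \<bar>l\<bar>" for s
        proof -
          have "norm (r s) \<le> e / C * norm (y + s *\<^sub>R w - x)"
            unfolding r_def using near[OF that] N by (intro bnd) auto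
          also have "\<dots> \<le> e / C * (N * C)"
            using near[OF that] e C by (intro mult_left_mono) auto
          finally show ?thesis using C by simp
        qed
        have "?D (y + s *\<^sub>R w - x) + ?D (y - s *\<^sub>R w - x) = 2 *\<^sub>R ?D (y - x)" for s
          unfolding matrix_vector_right_distrib[symmetric] matrix_vector_mult_scaleR[symmetric]
          by (rule arg_cong[of _ _ ?D]) (simp add: vec_eq_iff)
        moreover have "(p - h - d) + (m - h - d') = p + m - 2 *\<^sub>R h - (d + d')" for p m h d d' :: "real^'n"
          by (simp add: vec_eq_iff)
        ultimately have "r (\<tau> p) + r (- \<tau> p) = hessian E (y + \<tau> p *\<^sub>R w) $ a + hessian E (y - \<tau> p *\<^sub>R w) $ a
            - 2 *\<^sub>R hessian E x $ a - 2 *\<^sub>R ?D (y - x)"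
          by (simp only: r_def scaleR_minus_left add_uminus_conv_diff)
        then have "K p - K (x, v, 0) - ?D (fst (p - (x, v, 0))) = (1/2) *\<^sub>R (r (\<tau> p) + r (- \<tau> p))"
          unfolding K0 K_def[of p] by (simp add: pe scaleR_right_diff_distrib)
        then have "norm (K p - K (x, v, 0) - ?D (fst (p - (x, v, 0)))) \<le> (1/2) * (norm (r (\<tau> p)) + norm (r (- \<tau> p)))"
          using norm_triangle_ineq[of "r (\<tau> p)" "r (- \<tau> p)"] by simp
        also have "\<dots> \<le> e * N" using r[of "\<tau> p"] r[of "- \<tau> p"] \<tau>(1)[of p] by (simp add: pe)
        finally show "norm (K p - K (x, v, 0) - ?D (fst (p - (x, v, 0)))) \<le> e * norm (p - (x, v, 0))"
          by (simp add: N_def)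
      qed
    qed
    then have "((\<lambda>p. K p \<bullet> fst (snd p)) has_derivative
       (\<lambda>p. K (x, v, 0) \<bullet> fst (snd p) + ?D (fst p) \<bullet> fst (snd (x, v, 0 :: real)))) (at (x, v, 0))"
      by (intro has_derivative_inner has_derivative_fst has_derivative_snd has_derivative_ident)
    then show ?thesis
      unfolding \<tau>(2) K_def[symmetric] K0
      by (simp add: T_def matrix_vector_mult_def inner_vec_def[of "hessian E x $ a"] add.commute)
  qed
  then have "((\<lambda>p. dimer E (fst p) (fst (snd p)) (snd (snd p))) has_derivative
      (\<lambda>p. T (fst p) + hessian E x *v fst (snd p))) (at (x, v, 0))"
    by (rule has_derivative_vecI)
  moreover have "linear T"
    by (rule linearI) (simp_all add: T_def vec_eq_iff matrix_vector_right_distrib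
        matrix_vector_mult_scaleR inner_add_left)
  ultimately show thesis by (intro that[of T]) (simp_all add: case_prod_unfold)
qed

section \<open>Phase space and linearization\<close>

definition xpart :: "real^(('d::finite, 'k::finite) coord) \<Rightarrow> real^'d" where "xpart s = (\<chi> a. s $ X a)"
definition mpart :: "real^(('d::finite, 'k::finite) coord) \<Rightarrow> real^'d" where "mpart s = (\<chi> a. s $ M a)"
definition vpart :: "real^(('d::finite, 'k::finite) coord) \<Rightarrow> 'k \<Rightarrow> real^'d" where "vpart s i = (\<chi> a. s $ V i a)"
definition lpart :: "real^(('d::finite, 'k::finite) coord) \<Rightarrow> real" where "lpart s = s $ L"

lemmas part_defs = xpart_def mpart_def vpart_def lpart_def

lemma parts_state [simp]:
  "xpart (state x m v l) = x" "mpart (state x m v l) = m"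
  "vpart (state x m v l) i = v i" "lpart (state x m v l) = l"
  by (simp_all add: part_defs state_def vec_eq_iff)

lemma state_eqI:
  assumes "xpart s = xpart t" "mpart s = mpart t" "\<And>i. vpart s i = vpart t i" "lpart s = lpart t"
  shows "s = t"
proof -
  have "s $ c = t $ c" for c
    using assms by (cases c) (simp_all add: part_defs vec_eq_iff)
  then show ?thesis by (simp add: vec_eq_iff)
qed

lemma parts_0 [simp]: "xpart 0 = 0" "mpart 0 = 0" "vpart 0 i = 0" "lpart 0 = 0"
  by (simp_all add: part_defs vec_eq_iff)

lemma parts_scaleR [simp]:
  "xpart (r *\<^sub>R s) = r *\<^sub>R xpart s" "mpart (r *\<^sub>R s) = r *\<^sub>R mpart s"
  "vpart (r *\<^sub>R s) i = r *\<^sub>R vpart s i" "lpart (r *\<^sub>R s) = r * lpart s"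
  by (simp_all add: part_defs vec_eq_iff)

lemma parts_add [simp]:
  "xpart (s + t) = xpart s + xpart t" "mpart (s + t) = mpart s + mpart t"
  "vpart (s + t) i = vpart s i + vpart t i" "lpart (s + t) = lpart s + lpart t"
  by (simp_all add: part_defs vec_eq_iff)

lemma parts_diff [simp]:
  "xpart (s - t) = xpart s - xpart t" "mpart (s - t) = mpart s - mpart t"
  "vpart (s - t) i = vpart s i - vpart t i" "lpart (s - t) = lpart s - lpart t"
  by (simp_all add: part_defs vec_eq_iff)

lemma has_derivative_parts [derivative_intros]:
  "(xpart has_derivative xpart) F" "(mpart has_derivative mpart) F"
  "((\<lambda>s. vpart s i) has_derivative (\<lambda>s. vpart s i)) F" "(lpart has_derivative lpart) F"
  by (auto intro!: bounded_linear_imp_has_derivative linear_conv_bounded_linear[THEN iffD1] linearI)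

lemma has_derivative_stateI:
  assumes "(f has_derivative f') (at s)" "(g has_derivative g') (at s)"
    "\<And>i. ((\<lambda>t. h t i) has_derivative (\<lambda>t. h' t i)) (at s)" "(e has_derivative e') (at s)"
  shows "((\<lambda>t. state (f t) (g t) (h t) (e t)) has_derivative (\<lambda>t. state (f' t) (g' t) (h' t) (e' t))) (at s)"
proof (rule has_derivative_vecI)
  fix c
  show "((\<lambda>t. state (f t) (g t) (h t) (e t) $ c) has_derivative (\<lambda>t. state (f' t) (g' t) (h' t) (e' t) $ c)) (at s)"
    using assms by (cases c) (auto simp: state_def intro!: bounded_linear.has_derivative[OF bounded_linear_vec_nth])
qed

lemma outer_mult_vec: "outer v w *v y = (w \<bullet> y) *\<^sub>R v"
  by (simp add: outer_def matrix_vector_mult_def inner_vec_def vec_eq_iff sum_distrib_left mult_ac)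

lemma sum_matrix_vector_mult:
  fixes B :: "'i \<Rightarrow> real^'n^'m"
  shows "(\<Sum>i\<in>S. B i) *v y = (\<Sum>i\<in>S. B i *v y)"
  by (induction S rule: infinite_finite_induct) (simp_all add: matrix_vector_mult_add_rdistrib)

lemma ahisd_rhs_parts:
  "ahisd_rhs E \<alpha>1 \<alpha>2 \<zeta> s = (let g = gradient E (xpart s); H = (\<lambda>i. dimer E (xpart s) (vpart s i) (lpart s)) in
     state (mpart s)
      (- \<alpha>1 *\<^sub>R mpart s - \<alpha>2 *\<^sub>R (g - 2 *\<^sub>R (\<Sum>i\<in>UNIV. (vpart s i \<bullet> g) *\<^sub>R vpart s i)))
      (\<lambda>i. - \<zeta> *\<^sub>R (H i - (vpart s i \<bullet> H i) *\<^sub>R vpart s i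
              - 2 *\<^sub>R (\<Sum>j\<in>{..<i}. (vpart s j \<bullet> H i) *\<^sub>R vpart s j)))
      (- lpart s))"
  unfolding ahisd_rhs_def Let_def part_defs[symmetric]
  by (simp add: matrix_vector_mult_diff_rdistrib sum_matrix_vector_mult outer_mult_vec
      scaleR_matrix_vector_assoc[symmetric])

text \<open>The situation at a steady state: the directions \<open>v\<^sub>i\<close> are orthonormal eigenvectors of the Hessian
  \<open>A\<close>, with no information yet about which eigenvalues they belong to.\<close>

locale eigenframe =
  fixes A :: "real^'d^'d" and v :: "'k::{finite,linorder} \<Rightarrow> real^'d" and \<mu> :: "'k \<Rightarrow> real"
  assumes self_adjoint: "\<And>y z. (A *v y) \<bullet> z = y \<bullet> (A *v z)"
    and orthonormal: "\<And>i j. v i \<bullet> v j = (if i = j then 1 else 0)"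
    and eigenvector: "\<And>i. A *v v i = \<mu> i *\<^sub>R v i"
begin

lemma inner_A: "v i \<bullet> (A *v y) = \<mu> i * (v i \<bullet> y)"
  by (metis self_adjoint eigenvector inner_scaleR_left)

text \<open>The derivative of the right-hand side at the point \<open>(x, 0, v, 0)\<close> when \<open>x\<close> is a critical point with
  Hessian \<open>A\<close>, as a function of the displacement \<open>h\<close>. The abbreviation \<open>H\<close> is the derivative of the
  dimer, whose value is \<open>\<mu>\<^sub>i v\<^sub>i\<close>; hence the products of displaced directions with the dimer reduce to
  multiples of \<open>\<mu>\<^sub>i\<close>.\<close>

definition linearization ::
  "real \<Rightarrow> real \<Rightarrow> real \<Rightarrow> ('k \<Rightarrow> real^'d \<Rightarrow> real^'d) \<Rightarrow> real^(('d, 'k) coord) \<Rightarrow> real^(('d, 'k) coord)" where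
  "linearization \<alpha>1 \<alpha>2 \<zeta> T h = (let H = (\<lambda>i. T i (xpart h) + A *v vpart h i) in
     state (mpart h)
      (- \<alpha>1 *\<^sub>R mpart h - \<alpha>2 *\<^sub>R (A *v xpart h - 2 *\<^sub>R (\<Sum>i\<in>UNIV. (v i \<bullet> (A *v xpart h)) *\<^sub>R v i)))
      (\<lambda>i. - \<zeta> *\<^sub>R (H i - (v i \<bullet> H i + \<mu> i * (vpart h i \<bullet> v i)) *\<^sub>R v i - \<mu> i *\<^sub>R vpart h i
              - 2 *\<^sub>R (\<Sum>j\<in>{..<i}. (v j \<bullet> H i + \<mu> i * (vpart h j \<bullet> v i)) *\<^sub>R v j)))
      (- lpart h))"

lemma has_derivative_ahisd_rhs:
  assumes E2: "\<And>a y. partial a E differentiable (at y)"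
    and E3: "\<And>a b. partial b (partial a E) differentiable (at x)"
    and A: "A = hessian E x" and crit: "gradient E x = 0"
  obtains T where "\<And>i. linear (T i)"
    "(ahisd_rhs E \<alpha>1 \<alpha>2 \<zeta> has_derivative linearization \<alpha>1 \<alpha>2 \<zeta> T) (at (state x 0 v 0))"
proof -
  have "\<exists>T. linear T \<and> ((\<lambda>(y, w, l). dimer E y w l) has_derivative (\<lambda>(y, w, l). T y + A *v w)) (at (x, v i, 0))"
    for i using has_derivative_dimer[OF E2 E3] A by metis
  then obtain T where lin: "\<And>i. linear (T i)"
    and T: "\<And>i. ((\<lambda>(y, w, l). dimer E y w l) has_derivative (\<lambda>(y, w, l). T i y + A *v w)) (at (x, v i, 0))"
    by metis
  let ?s = "state x 0 v 0"
  have H: "((\<lambda>s. dimer E (xpart s) (vpart s i) (lpart s)) has_derivative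
      (\<lambda>h. T i (xpart h) + A *v vpart h i)) (at ?s)" for i
  proof -
    have "((\<lambda>s. (xpart s, vpart s i, lpart s)) has_derivative (\<lambda>s. (xpart s, vpart s i, lpart s))) (at ?s)"
      by (intro derivative_intros)
    from has_derivative_compose[OF this, of "\<lambda>(y, w, l). dimer E y w l" "\<lambda>(y, w, l). T i y + A *v w"]
    show ?thesis using T[of i] by simp
  qed
  have g: "((\<lambda>s. gradient E (xpart s)) has_derivative (\<lambda>h. A *v xpart h)) (at ?s)"
    using has_derivative_compose[OF has_derivative_parts(1), of "gradient E" "(*v) A" ?s UNIV]
      has_derivative_gradient_hessian[OF E2, of x] A by simp
  have H0: "dimer E x (v i) 0 = \<mu> i *\<^sub>R v i" for i
    by (simp add: dimer_zero E2 A[symmetric] eigenvector)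
  have "((\<lambda>s. let g = gradient E (xpart s); H = (\<lambda>i. dimer E (xpart s) (vpart s i) (lpart s)) in
     state (mpart s)
      (- \<alpha>1 *\<^sub>R mpart s - \<alpha>2 *\<^sub>R (g - 2 *\<^sub>R (\<Sum>i\<in>UNIV. (vpart s i \<bullet> g) *\<^sub>R vpart s i)))
      (\<lambda>i. - \<zeta> *\<^sub>R (H i - (vpart s i \<bullet> H i) *\<^sub>R vpart s i
              - 2 *\<^sub>R (\<Sum>j\<in>{..<i}. (vpart s j \<bullet> H i) *\<^sub>R vpart s j)))
      (- lpart s)) has_derivative linearization \<alpha>1 \<alpha>2 \<zeta> T) (at ?s)"
    unfolding linearization_def[abs_def] Let_def
  proof (rule has_derivative_stateI)
    show "((\<lambda>s. - \<alpha>1 *\<^sub>R mpart s - \<alpha>2 *\<^sub>R (gradient E (xpart s)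
          - 2 *\<^sub>R (\<Sum>i\<in>UNIV. (vpart s i \<bullet> gradient E (xpart s)) *\<^sub>R vpart s i))) has_derivative
        (\<lambda>h. - \<alpha>1 *\<^sub>R mpart h - \<alpha>2 *\<^sub>R (A *v xpart h - 2 *\<^sub>R (\<Sum>i\<in>UNIV. (v i \<bullet> (A *v xpart h)) *\<^sub>R v i)))) (at ?s)"
      by (rule has_derivative_eq_rhs, (rule derivative_intros g)+) (simp add: crit)
  next
    fix i
    show "((\<lambda>s. - \<zeta> *\<^sub>R (dimer E (xpart s) (vpart s i) (lpart s)
          - (vpart s i \<bullet> dimer E (xpart s) (vpart s i) (lpart s)) *\<^sub>R vpart s i
          - 2 *\<^sub>R (\<Sum>j\<in>{..<i}. (vpart s j \<bullet> dimer E (xpart s) (vpart s i) (lpart s)) *\<^sub>R vpart s j))) has_derivative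
        (\<lambda>h. - \<zeta> *\<^sub>R (T i (xpart h) + A *v vpart h i
          - (v i \<bullet> (T i (xpart h) + A *v vpart h i) + \<mu> i * (vpart h i \<bullet> v i)) *\<^sub>R v i - \<mu> i *\<^sub>R vpart h i
          - 2 *\<^sub>R (\<Sum>j\<in>{..<i}. (v j \<bullet> (T i (xpart h) + A *v vpart h i) + \<mu> i * (vpart h j \<bullet> v i)) *\<^sub>R v j)))) (at ?s)"
    proof (rule has_derivative_eq_rhs, (rule derivative_intros H)+, rule ext, goal_cases)
      case (1 h)
      have "(v j \<bullet> dimer E x (v i) 0) = 0" if "j < i" for j
        using that by (simp add: H0 orthonormal)
      then have "(\<Sum>j\<in>{..<i}. (v j \<bullet> dimer E x (v i) 0) *\<^sub>R vpart h j +
          (v j \<bullet> (T i (xpart h) + A *v vpart h i) + vpart h j \<bullet> dimer E x (v i) 0) *\<^sub>R v j)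
        = (\<Sum>j\<in>{..<i}. (v j \<bullet> (T i (xpart h) + A *v vpart h i) + \<mu> i * (vpart h j \<bullet> v i)) *\<^sub>R v j)"
        by (intro sum.cong refl) (simp add: H0)
      then show ?case by (simp add: H0 orthonormal algebra_simps)
    qed
  qed (auto intro!: derivative_eq_intros)
  then show thesis
    unfolding ahisd_rhs_parts[abs_def, symmetric] using lin by (intro that) (simp_all add: ahisd_rhs_parts[abs_def])
qed

end

section \<open>Linear stability through the real derivative\<close>

lemma eigenvalue_complexification_iff:
  fixes J :: "real^'n^'n"
  shows "eigenvalue (map_matrix complex_of_real J) \<rho> \<longleftrightarrow>
    (\<exists>a b. (a \<noteq> 0 \<or> b \<noteq> 0) \<and> J *v a = Re \<rho> *\<^sub>R a - Im \<rho> *\<^sub>R b \<and> J *v b = Im \<rho> *\<^sub>R a + Re \<rho> *\<^sub>R b)"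
    (is "?l \<longleftrightarrow> ?r")
proof -
  have eq: "map_matrix complex_of_real J *v z = \<rho> *s z \<longleftrightarrow>
      J *v (\<chi> i. Re (z $ i)) = Re \<rho> *\<^sub>R (\<chi> i. Re (z $ i)) - Im \<rho> *\<^sub>R (\<chi> i. Im (z $ i)) \<and>
      J *v (\<chi> i. Im (z $ i)) = Im \<rho> *\<^sub>R (\<chi> i. Re (z $ i)) + Re \<rho> *\<^sub>R (\<chi> i. Im (z $ i))" for z
    by (auto simp: vec_eq_iff matrix_vector_mult_def complex_eq_iff add.commute)
  show ?thesis
  proof
    assume ?l
    then obtain z where z: "z \<noteq> 0" "map_matrix complex_of_real J *v z = \<rho> *s z"
      by (auto simp: eigenvalue_def)
    moreover have "(\<chi> i. Re (z $ i)) \<noteq> 0 \<or> (\<chi> i. Im (z $ i)) \<noteq> 0"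
      using z(1) by (auto simp: vec_eq_iff complex_eq_iff)
    ultimately show ?r unfolding eq by blast
  next
    assume ?r
    then obtain a b where ab: "a \<noteq> 0 \<or> b \<noteq> 0" "J *v a = Re \<rho> *\<^sub>R a - Im \<rho> *\<^sub>R b"
      "J *v b = Im \<rho> *\<^sub>R a + Re \<rho> *\<^sub>R b" by blast
    define z where "z = (\<chi> i. Complex (a $ i) (b $ i))"
    have "(\<chi> i. Re (z $ i)) = a" "(\<chi> i. Im (z $ i)) = b" by (simp_all add: z_def vec_eq_iff)
    with ab have "map_matrix complex_of_real J *v z = \<rho> *s z" by (simp add: eq)
    moreover have "z \<noteq> 0" using ab(1) by (auto simp: z_def vec_eq_iff complex_eq_iff)
    ultimately show ?l by (auto simp: eigenvalue_def)
  qed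
qed

text \<open>A complex eigenvector \<open>a + \<i> b\<close> of the Jacobian is a pair of real vectors. In this form stability is
  a statement about the derivative as a real linear map, without complex matrices.\<close>

lemma linearly_stable_iff:
  assumes "(F has_derivative D) (at p)"
  shows "linearly_stable F p \<longleftrightarrow> (\<forall>\<rho> a b. a \<noteq> 0 \<or> b \<noteq> 0 \<longrightarrow>
    D a = Re \<rho> *\<^sub>R a - Im \<rho> *\<^sub>R b \<longrightarrow> D b = Im \<rho> *\<^sub>R a + Re \<rho> *\<^sub>R b \<longrightarrow> Re \<rho> < 0)"
proof -
  have "(F has_derivative (*v) (jacobian F (at p))) (at p)"
    using assms jacobian_works differentiableI by blast
  then have "(*v) (jacobian F (at p)) = D" by (rule has_derivative_unique[OF _ assms])
  then have D: "jacobian F (at p) *v h = D h" for h by (rule fun_cong)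
  show ?thesis unfolding linearly_stable_def eigenvalue_complexification_iff D by blast
qed

lemma linearly_stable_real_eigenvector:
  assumes "(F has_derivative D) (at p)" and "linearly_stable F p" and "a \<noteq> 0" and "D a = r *\<^sub>R a"
  shows "r < 0"
proof -
  have "D 0 = 0" using has_derivative_linear[OF assms(1)] by (rule linear_0)
  then show ?thesis
    using assms(2)[unfolded linearly_stable_iff[OF assms(1)], rule_format, of a 0 "of_real r"] assms(3,4)
    by simp
qed

text \<open>A non-real root has real part \<open>- \<alpha> / 2\<close>; a real root cannot be nonnegative because then all terms
  on the left would be nonnegative and \<open>\<kappa>\<close> positive.\<close>

lemma damped_oscillator_stable:
  fixes \<rho> :: complex and \<alpha> \<kappa> :: real
  assumes "\<alpha> > 0" "\<kappa> > 0" and root: "\<rho>\<^sup>2 + \<alpha> * \<rho> + \<kappa> = 0"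
  shows "Re \<rho> < 0"
proof (rule ccontr)
  assume "\<not> Re \<rho> < 0"
  then have r: "Re \<rho> \<ge> 0" by simp
  have im: "Im \<rho> * (2 * Re \<rho> + \<alpha>) = 0" and re: "(Re \<rho>)\<^sup>2 - (Im \<rho>)\<^sup>2 + \<alpha> * Re \<rho> + \<kappa> = 0"
    using arg_cong[OF root, of Im] arg_cong[OF root, of Re]
    by (simp_all add: power2_eq_square algebra_simps)
  from im r assms have "Im \<rho> = 0" by auto
  with re have "(Re \<rho>)\<^sup>2 + \<alpha> * Re \<rho> + \<kappa> = 0" by simp
  moreover have "(Re \<rho>)\<^sup>2 + \<alpha> * Re \<rho> \<ge> 0" using r assms by simp
  ultimately show False using assms(2) by linarith
qed

section \<open>Steady states\<close>

text \<open>Induction along the order of the directions. Put \<open>c\<^sub>j = v\<^sub>j \<bullet> v\<^sub>i\<close> for \<open>j < i\<close>. Pairing the equation of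
  \<open>v\<^sub>i\<close> with \<open>v\<^sub>j\<close> gives \<open>(\<mu>\<^sub>i + \<mu>\<^sub>j) c\<^sub>j = 0\<close>, pairing it with \<open>v\<^sub>i\<close> gives \<open>\<Sum>\<^sub>j \<mu>\<^sub>j c\<^sub>j\<^sup>2 = 0\<close>. The terms of this
  sum may have either sign in general, but by the first relation \<open>\<mu>\<^sub>j\<close> can be replaced by \<open>- \<mu>\<^sub>i\<close> in
  all of them. So \<open>\<mu>\<^sub>i \<Sum>\<^sub>j c\<^sub>j\<^sup>2 = 0\<close>, and if some \<open>c\<^sub>j\<close> were nonzero, then \<open>\<mu>\<^sub>i = - \<mu>\<^sub>j\<close> would be
  nonzero by the injectivity of \<open>A\<close>, a contradiction.\<close>

lemma stationary_directions_eigenframe: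
  fixes A :: "real^'d^'d" and v :: "'k::{finite,linorder} \<Rightarrow> real^'d"
  assumes adj: "\<And>y z. (A *v y) \<bullet> z = y \<bullet> (A *v z)" and inj: "\<And>y. A *v y = 0 \<Longrightarrow> y = 0"
    and unit: "\<And>i. norm (v i) = 1"
    and stat: "\<And>i. A *v v i = (v i \<bullet> (A *v v i)) *\<^sub>R v i
                 + 2 *\<^sub>R (\<Sum>j\<in>{..<i}. (v j \<bullet> (A *v v i)) *\<^sub>R v j)"
  shows "eigenframe A v (\<lambda>i. v i \<bullet> (A *v v i))"
proof -
  define \<mu> where "\<mu> i = v i \<bullet> (A *v v i)" for i
  have vv: "v i \<bullet> v i = 1" for i using unit[of i] by (simp add: norm_eq_1)
  have ind: "(\<forall>j<i. v j \<bullet> v i = 0) \<and> A *v v i = \<mu> i *\<^sub>R v i" for i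
  proof (induction i rule: measure_induct_rule[where f = number])
    case (less i)
    have IH: "v p \<bullet> v j = 0" if "p < j" "j < i" for p j
      using less[of j] that strict_mono_number by (auto simp: strict_mono_def)
    have eig: "A *v v j = \<mu> j *\<^sub>R v j" if "j < i" for j
      using less[of j] that strict_mono_number by (auto simp: strict_mono_def)
    have orth: "v p \<bullet> v j = 0" if "p < i" "j < i" "p \<noteq> j" for p j
      using that IH[of p j] IH[of j p] by (cases p j rule: linorder_cases) (auto simp: inner_commute)
    define c where "c j = v j \<bullet> v i" for j
    have Ac: "v j \<bullet> (A *v v i) = \<mu> j * c j" if "j < i" for j
      by (metis adj eig[OF that] inner_scaleR_left c_def)
    have eq: "A *v v i = \<mu> i *\<^sub>R v i + 2 *\<^sub>R (\<Sum>j\<in>{..<i}. (\<mu> j * c j) *\<^sub>R v j)"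
      using stat[of i] by (simp add: \<mu>_def Ac)
    have opp: "(\<mu> i + \<mu> j) * c j = 0" if j: "j < i" for j
    proof -
      have "(\<Sum>p\<in>{..<i}. (\<mu> p * c p) * (v j \<bullet> v p)) = (\<Sum>p\<in>{..<i}. if p = j then \<mu> j * c j else 0)"
        using j orth vv by (intro sum.cong) auto
      then have "\<mu> j * c j = \<mu> i * c j + 2 * (\<mu> j * c j)"
        using arg_cong[OF eq, of "\<lambda>y. v j \<bullet> y"] j
        by (simp add: Ac inner_add_right inner_sum_right c_def)
      then show ?thesis by (simp add: algebra_simps)
    qed
    have "\<mu> i = \<mu> i + 2 * (\<Sum>p\<in>{..<i}. (\<mu> p * c p) * c p)"
      using arg_cong[OF eq, of "\<lambda>y. v i \<bullet> y"]
      by (simp add: \<mu>_def[of i, symmetric] inner_add_right inner_sum_right c_def vv inner_commute)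
    moreover have "(\<mu> p * c p) * c p = - \<mu> i * (c p)\<^sup>2" if "p < i" for p
      using opp[OF that] by (simp add: power2_eq_square) algebra
    ultimately have "\<mu> i * (\<Sum>p\<in>{..<i}. (c p)\<^sup>2) = 0"
      by (simp add: sum_distrib_left[symmetric] sum_negf)
    have c0: "c j = 0" if j: "j < i" for j
    proof (rule ccontr)
      assume "c j \<noteq> 0"
      have "\<mu> j \<noteq> 0" using eig[OF j] inj[of "v j"] vv[of j] by force
      with opp[OF j] \<open>c j \<noteq> 0\<close> have "\<mu> i \<noteq> 0" by auto
      then have "(\<Sum>p\<in>{..<i}. (c p)\<^sup>2) = 0" using \<open>\<mu> i * _ = 0\<close> by simp
      then have "c j = 0" using j by (subst (asm) sum_nonneg_eq_0_iff) auto
      with \<open>c j \<noteq> 0\<close> show False by simp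
    qed
    then show ?case using eq by (simp add: c_def)
  qed
  show ?thesis
  proof
    fix i j
    show "v i \<bullet> v j = (if i = j then 1 else 0)"
      using ind[of i] ind[of j] vv by (cases i j rule: linorder_cases) (auto simp: inner_commute)
  qed (use adj ind \<mu>_def in auto)
qed

text \<open>At the least index where \<open>f\<close> and \<open>g\<close> differ, the smaller of the two values would have to be attained
  by the other function at an earlier index. Both functions agree there, against injectivity.\<close>

lemma strict_mono_same_range_imp_eq:
  fixes f g :: "'k::{finite,linorder} \<Rightarrow> 'a::linorder"
  assumes f: "strict_mono f" and g: "strict_mono g" and ran: "range f = range g"
  shows "f = g"
proof (rule ccontr)
  assume "f \<noteq> g"
  define i where "i = Min {i. f i \<noteq> g i}"
  have "f i \<noteq> g i" using Min_in[of "{i. f i \<noteq> g i}"] \<open>f \<noteq> g\<close> by (auto simp: i_def)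
  have eq: "f j = g j" if "j < i" for j
    using that Min_le[of "{i. f i \<noteq> g i}" j] by (fastforce simp: i_def)
  obtain p q where "f i = g p" "g i = f q" using ran by (metis rangeI image_iff)
  then have "p < i \<or> q < i"
    using \<open>f i \<noteq> g i\<close> f g by (metis linorder_cases order.asym strict_mono_less)
  then show False
    using eq f g \<open>f i = g p\<close> \<open>g i = f q\<close> by (metis less_irrefl strict_mono_eq)
qed

section \<open>Spectrum of the linearization\<close>

context eigenframe begin

lemma sum_orthonormal: "(\<Sum>j\<in>S. f j * (v i \<bullet> v j)) = (if i \<in> S then f i else 0)"
  by (simp add: orthonormal if_distrib cong: if_cong)

lemma eigenvectors_range: "orthonormal_eigenvectors ((*v) A) (range v)"
  by (auto simp: orthonormal_eigenvectors_def pairwise_def orthogonal_def norm_eq_1 orthonormal eigenvector)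

lemma inj_frame: "inj v"
  by (rule injI) (metis orthonormal zero_neq_one)

lemma eigenbasis_extending_frame:
  obtains R where "finite R" "span (range v \<union> R) = UNIV"
    "\<forall>u\<in>R. \<forall>i. u \<bullet> v i = 0" "\<forall>u\<in>R. A *v u = (u \<bullet> (A *v u)) *\<^sub>R u"
    "eigenvalues A = image_mset \<mu> (mset_set UNIV) + image_mset (\<lambda>u. u \<bullet> (A *v u)) (mset_set R)"
proof -
  obtain B where B: "range v \<subseteq> B" "orthonormal_eigenvectors ((*v) A) B" "span B = UNIV"
    by (rule orthonormal_eigenbasis_extension[OF matrix_vector_mul_linear self_adjoint eigenvectors_range])
  have "independent B"
    using B(2) by (intro pairwise_orthogonal_independent) (force simp: orthonormal_eigenvectors_def)+
  then have fin: "finite B" by (rule independent_imp_finite)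
  have "u \<bullet> v i = 0" if "u \<in> B - range v" for u i
    using that B(1,2) by (auto simp: orthonormal_eigenvectors_def pairwise_def orthogonal_def)
  moreover have "eigenvalues A = image_mset \<mu> (mset_set UNIV)
      + image_mset (\<lambda>u. u \<bullet> (A *v u)) (mset_set (B - range v))"
  proof -
    have "mset_set B = mset_set (range v) + mset_set (B - range v)"
      using mset_set_Union[of "range v" "B - range v"] fin B(1) by (simp add: Un_absorb1)
    moreover have "mset_set (range v) = image_mset v (mset_set UNIV)"
      by (simp add: image_mset_mset_set inj_frame)
    ultimately show ?thesis
      by (simp add: eigenvalues_orthonormal_eigenbasis[OF B(2,3)] image_mset.compositionality o_def
          inner_A orthonormal)
  qed
  ultimately show thesis
    using B fin by (intro that[of "B - range v"]) (auto simp: orthonormal_eigenvectors_def Un_absorb1)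
qed

lemma vpart_linearization:
  assumes "\<And>i. linear (T i)" and "xpart h = 0"
  shows "vpart (linearization \<alpha>1 \<alpha>2 \<zeta> T h) i = - \<zeta> *\<^sub>R (A *v vpart h i
    - (2 * \<mu> i * (v i \<bullet> vpart h i)) *\<^sub>R v i - \<mu> i *\<^sub>R vpart h i
    - 2 *\<^sub>R (\<Sum>j\<in>{..<i}. (\<mu> j * (v j \<bullet> vpart h i) + \<mu> i * (vpart h j \<bullet> v i)) *\<^sub>R v j))"
  using assms(2) by (simp add: linearization_def Let_def linear_0[OF assms(1)] inner_A inner_commute)

text \<open>Displacing \<open>v\<^sub>i\<close> along itself, which leaves the unit sphere, is an eigenvector of the linearization
  with eigenvalue \<open>2 \<zeta> \<mu>\<^sub>i\<close>: it does not influence later directions, as these are orthogonal to \<open>v\<^sub>i\<close>.\<close>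

lemma eigenvalue_negative_if_stable:
  assumes "\<zeta> > 0" and T: "\<And>i. linear (T i)"
    and F: "(F has_derivative linearization \<alpha>1 \<alpha>2 \<zeta> T) (at p)" "linearly_stable F p"
  shows "\<mu> i < 0"
proof -
  define s where "s = state 0 0 (\<lambda>p. if p = i then v i else 0) 0"
  have "linearization \<alpha>1 \<alpha>2 \<zeta> T s = (2 * \<zeta> * \<mu> i) *\<^sub>R s"
  proof (rule state_eqI)
    fix p
    have "(\<Sum>j<p. (\<mu> j * (v j \<bullet> vpart s p) + \<mu> p * (vpart s j \<bullet> v p)) *\<^sub>R v j) = 0"
      by (rule sum.neutral) (auto simp: s_def orthonormal)
    then have "vpart (linearization \<alpha>1 \<alpha>2 \<zeta> T s) p = - \<zeta> *\<^sub>R (A *v vpart s p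
        - (2 * \<mu> p * (v p \<bullet> vpart s p)) *\<^sub>R v p - \<mu> p *\<^sub>R vpart s p)"
      by (simp add: vpart_linearization T s_def)
    then show "vpart (linearization \<alpha>1 \<alpha>2 \<zeta> T s) p = vpart ((2 * \<zeta> * \<mu> i) *\<^sub>R s) p"
      by (simp add: s_def eigenvector orthonormal vec_eq_iff)
  qed (simp_all add: linearization_def s_def)
  moreover have "vpart s i \<noteq> 0" using orthonormal[of i i] by (auto simp: s_def)
  then have "s \<noteq> 0" by auto
  ultimately have "2 * \<zeta> * \<mu> i < 0" by (intro linearly_stable_real_eigenvector[OF F])
  with \<open>\<zeta> > 0\<close> show ?thesis by (simp add: mult_less_0_iff)
qed

text \<open>The infinitesimal rotation in the plane of \<open>v\<^sub>i\<close> and \<open>v\<^sub>j\<close> is an eigenvector of the linearization. The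
  block of \<open>v\<^sub>i\<close> fixes the eigenvalue \<open>\<zeta> (\<mu>\<^sub>i - \<mu>\<^sub>j)\<close> of the displacement \<open>v\<^sub>j\<close> of \<open>v\<^sub>i\<close>; this displacement
  acts on the later direction \<open>v\<^sub>j\<close> only, and the simultaneous displacement \<open>- v\<^sub>i\<close> of \<open>v\<^sub>j\<close> is what
  balances it there.\<close>

lemma eigenvalue_increasing_if_stable:
  assumes "\<zeta> > 0" and T: "\<And>i. linear (T i)"
    and F: "(F has_derivative linearization \<alpha>1 \<alpha>2 \<zeta> T) (at p)" "linearly_stable F p"
    and ij: "i < j"
  shows "\<mu> i < \<mu> j"
proof -
  define s where "s = state 0 0 (\<lambda>p. if p = i then v j else if p = j then - v i else 0) 0"
  have "linearization \<alpha>1 \<alpha>2 \<zeta> T s = (\<zeta> * (\<mu> i - \<mu> j)) *\<^sub>R s"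
  proof (rule state_eqI)
    fix p
    have "(\<Sum>q<p. (\<mu> q * (v q \<bullet> vpart s p) + \<mu> p * (vpart s q \<bullet> v p)) *\<^sub>R v q)
        = (\<Sum>q<p. if q = i then (if p = j then (\<mu> j - \<mu> i) *\<^sub>R v i else 0) else 0)"
      using ij by (intro sum.cong) (auto simp: s_def orthonormal)
    also have "\<dots> = (if p = j then (\<mu> j - \<mu> i) *\<^sub>R v i else 0)"
      using ij by auto
    finally have "vpart (linearization \<alpha>1 \<alpha>2 \<zeta> T s) p = - \<zeta> *\<^sub>R (A *v vpart s p
        - (2 * \<mu> p * (v p \<bullet> vpart s p)) *\<^sub>R v p - \<mu> p *\<^sub>R vpart s p
        - 2 *\<^sub>R (if p = j then (\<mu> j - \<mu> i) *\<^sub>R v i else 0))"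
      by (simp add: vpart_linearization T s_def)
    then show "vpart (linearization \<alpha>1 \<alpha>2 \<zeta> T s) p = vpart ((\<zeta> * (\<mu> i - \<mu> j)) *\<^sub>R s) p"
      using ij by (auto simp: s_def eigenvector orthonormal linear_neg vec_eq_iff algebra_simps)
  qed (simp_all add: linearization_def s_def)
  moreover have "vpart s i \<noteq> 0" using orthonormal[of j j] by (auto simp: s_def)
  then have "s \<noteq> 0" by auto
  ultimately have "\<zeta> * (\<mu> i - \<mu> j) < 0" by (intro linearly_stable_real_eigenvector[OF F])
  with \<open>\<zeta> > 0\<close> show ?thesis by (simp add: mult_less_0_iff)
qed

text \<open>The reflection turns \<open>A\<close> into the matrix with the same eigenvectors in which the eigenvalues of the
  \<open>v\<^sub>i\<close> have changed sign. The next lemma does the same for the diagonal block of \<open>v\<^sub>i\<close>. Both are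
  stated as actions on left eigenvectors, so that they apply to an arbitrary displacement.\<close>

lemma reflected_pairing:
  assumes "u \<in> range v \<or> (\<forall>i. u \<bullet> v i = 0)" and u: "A *v u = \<nu> *\<^sub>R u"
  shows "u \<bullet> (A *v y - 2 *\<^sub>R (\<Sum>i\<in>UNIV. (v i \<bullet> (A *v y)) *\<^sub>R v i))
    = (if u \<in> range v then - \<nu> else \<nu>) * (u \<bullet> y)"
proof -
  have uA: "u \<bullet> (A *v y) = \<nu> * (u \<bullet> y)" by (metis self_adjoint u inner_scaleR_left)
  show ?thesis
  proof (cases "u \<in> range v")
    case True
    then obtain i where "u = v i" by auto
    with uA show ?thesis
      by (simp add: inner_diff_right inner_sum_right sum_orthonormal)
  next
    case False
    then show ?thesis using assms(1) uA by (simp add: inner_diff_right inner_sum_right)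
  qed
qed

lemma direction_pairing:
  assumes u: "u \<in> range v \<or> (\<forall>j. u \<bullet> v j = 0)" "A *v u = \<nu> *\<^sub>R u"
  shows "u \<bullet> (A *v w - (2 * \<mu> i * (v i \<bullet> w)) *\<^sub>R v i - \<mu> i *\<^sub>R w
      - 2 *\<^sub>R (\<Sum>j\<in>{..<i}. (\<mu> j * (v j \<bullet> w)) *\<^sub>R v j))
    = (\<nu> - \<mu> i - (if u \<in> v ` {..i} then 2 * \<nu> else 0)) * (u \<bullet> w)"
proof -
  have uA: "u \<bullet> (A *v w) = \<nu> * (u \<bullet> w)" by (metis self_adjoint u(2) inner_scaleR_left)
  show ?thesis
  proof (cases "u \<in> range v")
    case True
    then obtain j where j: "u = v j" by auto
    have "\<nu> = v j \<bullet> (A *v v j)" unfolding u(2)[unfolded j] by (simp add: orthonormal)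
    then have "\<nu> = \<mu> j" by (simp add: inner_A orthonormal)
    moreover have "u \<in> v ` {..i} \<longleftrightarrow> j \<le> i" using inj_frame j by (auto simp: inj_def)
    moreover have "v j \<bullet> (A *v w - (2 * \<mu> i * (v i \<bullet> w)) *\<^sub>R v i - \<mu> i *\<^sub>R w
        - 2 *\<^sub>R (\<Sum>p\<in>{..<i}. (\<mu> p * (v p \<bullet> w)) *\<^sub>R v p))
      = \<mu> j * (v j \<bullet> w) - 2 * \<mu> i * (v i \<bullet> w) * (v j \<bullet> v i) - \<mu> i * (v j \<bullet> w)
        - 2 * (if j \<in> {..<i} then \<mu> j * (v j \<bullet> w) else 0)"
      by (simp only: inner_diff_right inner_sum_right inner_scaleR_right sum_orthonormal inner_A)
    ultimately show ?thesis
      unfolding j by (cases "j < i"; cases "j = i") (auto simp: orthonormal algebra_simps le_less)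
  next
    case False
    then have "\<And>j. u \<bullet> v j = 0" "u \<notin> v ` {..i}" using u(1) by auto
    then show ?thesis using uA by (simp add: inner_diff_right inner_sum_right algebra_simps)
  qed
qed

text \<open>Take an eigenvector and its first nonzero block in the order \<open>l\<close>, \<open>(x, m)\<close>, \<open>v\<^sub>1\<close>, \<dots>, \<open>v\<^sub>k\<close>. All earlier
  blocks vanish, so this block is an eigenvector of the diagonal block for the same \<open>\<rho>\<close>. Some element
  \<open>u\<close> of the eigenbasis has a nonzero inner product with it, and pairing with \<open>u\<close> leaves a scalar
  equation for \<open>\<rho>\<close>.\<close>

lemma stable_if_lowest:
  assumes pos: "\<alpha>1 > 0" "\<alpha>2 > 0" "\<zeta> > 0" and T: "\<And>i. linear (T i)"
    and F: "(F has_derivative linearization \<alpha>1 \<alpha>2 \<zeta> T) (at p)"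
    and neg: "\<And>i. \<mu> i < 0" and mono: "strict_mono \<mu>"
    and R: "span (range v \<union> R) = UNIV" "\<forall>u\<in>R. \<forall>i. u \<bullet> v i = 0"
      "\<forall>u\<in>R. A *v u = (u \<bullet> (A *v u)) *\<^sub>R u" "\<forall>u\<in>R. u \<bullet> (A *v u) > 0"
  shows "linearly_stable F p"
  unfolding linearly_stable_iff[OF F]
proof (intro allI impI)
  fix \<rho> :: complex and a b :: "real^('d, 'k) coord"
  let ?D = "linearization \<alpha>1 \<alpha>2 \<zeta> T"
  assume ab: "a \<noteq> 0 \<or> b \<noteq> 0" and Da: "?D a = Re \<rho> *\<^sub>R a - Im \<rho> *\<^sub>R b"
    and Db: "?D b = Im \<rho> *\<^sub>R a + Re \<rho> *\<^sub>R b"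
  let ?B = "range v \<union> R"
  have B: "u \<in> range v \<or> (\<forall>j. u \<bullet> v j = 0)" "A *v u = (u \<bullet> (A *v u)) *\<^sub>R u" if "u \<in> ?B" for u
    using that R by (auto simp: eigenvector orthonormal)
  have sep: "\<exists>u\<in>?B. u \<bullet> y \<noteq> 0" if "y \<noteq> 0" for y
  proof (rule ccontr)
    assume "\<not> (\<exists>u\<in>?B. u \<bullet> y \<noteq> 0)"
    then have "orthogonal y u" if "u \<in> ?B" for u using that by (simp add: orthogonal_def inner_commute)
    then have "orthogonal y y" by (rule orthogonal_to_span[of y ?B, unfolded R(1), OF UNIV_I])
    with \<open>y \<noteq> 0\<close> show False by (simp add: orthogonal_self)
  qed
  consider (l) "lpart a \<noteq> 0 \<or> lpart b \<noteq> 0" | (x) "xpart a \<noteq> 0 \<or> xpart b \<noteq> 0"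
    | (v) "lpart a = 0" "lpart b = 0" "xpart a = 0" "xpart b = 0" by blast
  then show "Re \<rho> < 0"
  proof cases
    case l
    have "\<rho> * Complex (lpart a) (lpart b) = - Complex (lpart a) (lpart b)"
      using arg_cong[OF Da, of lpart] arg_cong[OF Db, of lpart]
      by (simp add: complex_eq_iff linearization_def Let_def)
    moreover have "Complex (lpart a) (lpart b) \<noteq> 0" using l by (auto simp: complex_eq_iff)
    ultimately have "\<rho> = -1" by (metis mult_cancel_right mult_minus1)
    then show ?thesis by simp
  next
    case x
    then obtain u where u: "u \<in> ?B" "u \<bullet> xpart a \<noteq> 0 \<or> u \<bullet> xpart b \<noteq> 0" using sep by blast
    define \<kappa> where "\<kappa> = (if u \<in> range v then - (u \<bullet> (A *v u)) else u \<bullet> (A *v u))"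
    have "\<kappa> > 0" using u(1) R(4) neg by (auto simp: \<kappa>_def inner_A orthonormal)
    define cx where "cx = Complex (u \<bullet> xpart a) (u \<bullet> xpart b)"
    define cm where "cm = Complex (u \<bullet> mpart a) (u \<bullet> mpart b)"
    have cm: "cm = \<rho> * cx"
      using arg_cong[OF Da, of "\<lambda>s. u \<bullet> xpart s"] arg_cong[OF Db, of "\<lambda>s. u \<bullet> xpart s"]
      by (simp add: complex_eq_iff linearization_def Let_def cx_def cm_def inner_add_right inner_diff_right)
    have "u \<bullet> mpart (?D s) = - \<alpha>1 * (u \<bullet> mpart s) - \<alpha>2 * (\<kappa> * (u \<bullet> xpart s))" for s
      using reflected_pairing[OF B[OF u(1)], of "xpart s"]
      by (simp add: linearization_def Let_def \<kappa>_def inner_diff_right[of u "- (\<alpha>1 *\<^sub>R _)"])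
    then have "\<rho> * cm = - \<alpha>1 * cm - \<alpha>2 * (\<kappa> * cx)"
      using arg_cong[OF Da, of "\<lambda>s. u \<bullet> mpart s"] arg_cong[OF Db, of "\<lambda>s. u \<bullet> mpart s"]
      by (simp add: complex_eq_iff cx_def cm_def inner_add_right inner_diff_right)
    then have "\<rho> * cm + \<alpha>1 * cm + \<alpha>2 * (\<kappa> * cx) = 0" by simp
    then have "(\<rho>\<^sup>2 + \<alpha>1 * \<rho> + complex_of_real (\<alpha>2 * \<kappa>)) * cx = 0"
      unfolding cm by (simp add: power2_eq_square algebra_simps)
    moreover have "cx \<noteq> 0" using u(2) by (auto simp: cx_def complex_eq_iff)
    ultimately show ?thesis
      using pos \<open>\<kappa> > 0\<close> by (intro damped_oscillator_stable[of \<alpha>1 "\<alpha>2 * \<kappa>"]) auto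
  next
    case v
    \<comment> \<open>As the velocity of \<open>x\<close>, the \<open>m\<close> part of an eigenvector is \<open>\<rho>\<close> times its \<open>x\<close> part.\<close>
    have "mpart a = 0" "mpart b = 0"
      using arg_cong[OF Da, of xpart] arg_cong[OF Db, of xpart] v
      by (simp_all add: linearization_def Let_def)
    define I where "I = {i. vpart a i \<noteq> 0 \<or> vpart b i \<noteq> 0}"
    have "I \<noteq> {}"
    proof
      assume "I = {}"
      then have "a = 0" "b = 0"
        using v \<open>mpart a = 0\<close> \<open>mpart b = 0\<close> by (auto simp: I_def intro!: state_eqI)
      with ab show False by simp
    qed
    define i where "i = Min I"
    have "i \<in> I" using \<open>I \<noteq> {}\<close> by (simp add: i_def)
    have below: "vpart a j = 0" "vpart b j = 0" if "j < i" for j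
      using that Min_le[of I j] by (fastforce simp: i_def I_def)+
    obtain u where u: "u \<in> ?B" "u \<bullet> vpart a i \<noteq> 0 \<or> u \<bullet> vpart b i \<noteq> 0"
      using \<open>i \<in> I\<close> sep unfolding I_def by blast
    define \<nu> where "\<nu> = u \<bullet> (A *v u)"
    define \<kappa> where "\<kappa> = - \<zeta> * (\<nu> - \<mu> i - (if u \<in> v ` {..i} then 2 * \<nu> else 0))"
    have "\<nu> - \<mu> i - (if u \<in> v ` {..i} then 2 * \<nu> else 0) > 0"
    proof (cases "u \<in> range v")
      case True
      then obtain j where j: "u = v j" by auto
      have "u \<in> v ` {..i} \<longleftrightarrow> j \<le> i" using inj_frame j by (auto simp: inj_def)
      moreover have "\<nu> = \<mu> j" by (simp add: \<nu>_def j inner_A orthonormal)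
      moreover have "\<mu> i < \<mu> j" if "\<not> j \<le> i" using that mono by (simp add: strict_mono_def)
      ultimately show ?thesis using neg[of i] neg[of j] by auto
    next
      case False
      then show ?thesis using u(1) R(4) neg[of i] by (auto simp: \<nu>_def)
    qed
    then have "\<kappa> < 0" using pos by (simp add: \<kappa>_def mult_less_0_iff)
    define c where "c = Complex (u \<bullet> vpart a i) (u \<bullet> vpart b i)"
    have "u \<bullet> vpart (?D s) i = \<kappa> * (u \<bullet> vpart s i)"
      if "xpart s = 0" "\<And>j. j < i \<Longrightarrow> vpart s j = 0" for s
      unfolding vpart_linearization[OF T that(1)]
      using direction_pairing[OF B[OF u(1)], of "vpart s i" i] that(2)
      by (simp add: \<kappa>_def \<nu>_def)
    then have "\<rho> * c = \<kappa> * c"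
      using arg_cong[OF Da, of "\<lambda>s. u \<bullet> vpart s i"] arg_cong[OF Db, of "\<lambda>s. u \<bullet> vpart s i"] v below
      by (simp add: complex_eq_iff c_def inner_add_right inner_diff_right)
    moreover have "c \<noteq> 0" using u(2) by (auto simp: c_def complex_eq_iff)
    ultimately have "\<rho> = \<kappa>" by simp
    with \<open>\<kappa> < 0\<close> show ?thesis by simp
  qed
qed

end

section \<open>Steady states of the accelerated dynamics and the equivalence\<close>

lemma C_class_3_differentiability:
  fixes E :: "real^'d \<Rightarrow> real"
  assumes "C_class 3 E"
  shows "E differentiable (at y)" "partial a E differentiable (at y)"
    "partial b (partial a E) differentiable (at y)"
  using assms
  by (auto simp: numeral_3_eq_3 differentiable_on_def)

lemma steady_state_iff:
  fixes E :: "real^'d \<Rightarrow> real" and x m :: "real^'d" and v :: "'k::{finite,linorder} \<Rightarrow> real^'d"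
  assumes E2: "\<And>a y. partial a E differentiable (at y)" and "\<alpha>2 \<noteq> 0" "\<zeta> \<noteq> 0"
  defines "A \<equiv> hessian E x"
  shows "steady_state (ahisd_rhs E \<alpha>1 \<alpha>2 \<zeta>) (state x m v l) \<longleftrightarrow>
     m = 0 \<and> l = 0 \<and> gradient E x = 2 *\<^sub>R (\<Sum>i\<in>UNIV. (v i \<bullet> gradient E x) *\<^sub>R v i) \<and>
     (\<forall>i. A *v v i = (v i \<bullet> (A *v v i)) *\<^sub>R v i + 2 *\<^sub>R (\<Sum>j\<in>{..<i}. (v j \<bullet> (A *v v i)) *\<^sub>R v j))"
    (is "_ \<longleftrightarrow> ?r")
proof -
  let ?F = "ahisd_rhs E \<alpha>1 \<alpha>2 \<zeta> (state x m v l)"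
  have "?F = 0 \<longleftrightarrow> xpart ?F = 0 \<and> mpart ?F = 0 \<and> (\<forall>i. vpart ?F i = 0) \<and> lpart ?F = 0"
    by (auto intro!: state_eqI)
  also have "\<dots> \<longleftrightarrow> ?r"
    using assms(2,3) dimer_zero[OF E2, of x]
    by (auto simp: ahisd_rhs_parts Let_def A_def diff_diff_eq)
  finally show ?thesis by (simp add: steady_state_def)
qed

context eigenframe begin

lemma reflection_fixes_only_zero:
  assumes "g = 2 *\<^sub>R (\<Sum>i\<in>UNIV. (v i \<bullet> g) *\<^sub>R v i)"
  shows "g = 0"
proof -
  have "v j \<bullet> g = 2 * (v j \<bullet> g)" for j
    using arg_cong[OF assms, of "\<lambda>y. v j \<bullet> y"] by (simp add: inner_sum_right sum_orthonormal)
  then have "v j \<bullet> g = 0" for j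
    by (metis add_cancel_right_left mult_2)
  with assms show ?thesis by simp
qed

end

lemma orthonormal_if_distinct_eigenvalues:
  fixes A :: "real^'d^'d"
  assumes adj: "\<And>y z. (A *v y) \<bullet> z = y \<bullet> (A *v z)" and unit: "\<And>i. norm (v i) = 1"
    and eig: "\<And>i. A *v v i = \<mu> i *\<^sub>R v i" and "inj \<mu>"
  shows "eigenframe A v \<mu>"
proof
  fix i j
  have "\<mu> i * (v i \<bullet> v j) = \<mu> j * (v i \<bullet> v j)"
    using adj[of "v i" "v j"] by (simp add: eig)
  then show "v i \<bullet> v j = (if i = j then 1 else 0)"
    using \<open>inj \<mu>\<close> unit[of i] by (auto simp: inj_eq norm_eq_1)
qed (rule adj eig)+

theorem theorem1:
  fixes E :: "real^'d \<Rightarrow> real"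
    and x m :: "real^'d"
    and v :: "'k::{finite,linorder} \<Rightarrow> real^'d"
    and l \<alpha>1 \<alpha>2 \<zeta> :: real
    and lam :: "nat \<Rightarrow> real"
    and k d :: nat
  assumes "k = CARD('k)" and "d = CARD('d)"
    and "1 \<le> k" and "k \<le> d"
    and "C_class 3 E"
    and "\<And>i. norm (v i) = 1"
    and "invertible (hessian E x)"
    and "eigenvalues (hessian E x) = image_mset lam (mset_set {1..d})"
    and "strict_mono_on {1..k} lam"
    and "\<forall>i\<in>{1..k}. lam i < 0"
    and "\<forall>i\<in>{k+1..d}. 0 < lam i"
    and "mono_on {k+1..d} lam"
    and "\<alpha>1 > 0" and "\<alpha>2 > 0" and "\<zeta> > 0"
    and "\<alpha>1\<^sup>2 \<le> 4 * \<alpha>2 * Min ((\<lambda>i. \<bar>lam i\<bar>) ` {1..k})"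
  shows "steady_state (ahisd_rhs E \<alpha>1 \<alpha>2 \<zeta>) (state x m v l) \<and>
         linearly_stable (ahisd_rhs E \<alpha>1 \<alpha>2 \<zeta>) (state x m v l)
     \<longleftrightarrow> index_saddle E k x \<and>
         (\<forall>i. hessian E x *v v i = lam (number i) *\<^sub>R v i) \<and>
         m = 0 \<and> l = 0"
proof -
  note k = assms(1) and kd = assms(4) and unit = assms(6) and eigs = assms(8)
    and lam_mono = assms(9) and lam_neg = assms(10) and lam_pos = assms(11)
    and \<alpha>1 = assms(13) and \<alpha>2 = assms(14) and \<zeta> = assms(15)
  note E123 = C_class_3_differentiability[OF assms(5)]
  define A where "A = hessian E x"
  let ?F = "ahisd_rhs E \<alpha>1 \<alpha>2 \<zeta>"
  have "transpose A = A"
    unfolding A_def by (intro hessian_symmetric E123 differentiable_imp_continuous_within)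
  then have adj: "(A *v y) \<bullet> z = y \<bullet> (A *v z)" for y z
    by (metis dot_lmul_matrix vector_transpose_matrix)
  have inj: "y = 0" if "A *v y = 0" for y
    using assms(7) that by (metis A_def invertible_def matrix_vector_mul_assoc matrix_vector_mul_lid matrix_vector_mult_0_right)
  have \<alpha>2_nz: "\<alpha>2 \<noteq> 0" and \<zeta>_nz: "\<zeta> \<noteq> 0" using \<alpha>2 \<zeta> by auto
  note steady = steady_state_iff[where x = x and m = m and v = v and l = l and ?\<alpha>1.0 = \<alpha>1 and ?\<alpha>2.0 = \<alpha>2 and \<zeta> = \<zeta>, OF E123(2) \<alpha>2_nz \<zeta>_nz, folded A_def]
  have number: "range (number :: 'k \<Rightarrow> nat) = {1..k}"
    using bij_betw_number[where 'k = 'k] k by (simp add: bij_betw_def)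
  define \<nu> where "\<nu> = (\<lambda>i :: 'k. lam (number i))"
  have \<nu>_mono: "strict_mono \<nu>"
  proof (rule strict_monoI)
    fix i j :: 'k assume "i < j"
    then have "number i < number j" by (rule strict_monoD[OF strict_mono_number])
    moreover have "number i \<in> {1..k}" "number j \<in> {1..k}" using number by blast+
    ultimately show "\<nu> i < \<nu> j" unfolding \<nu>_def using strict_mono_onD[OF lam_mono] by blast
  qed
  have \<nu>_neg: "\<nu> i < 0" for i
    unfolding \<nu>_def using lam_neg number by blast
  have split: "{1..d} = {1..k} \<union> {k+1..d}" using kd by auto
  have mset_split: "mset_set {1..d} = mset_set {1..k} + mset_set {k+1..d}"
    unfolding split by (rule mset_set_Union) auto
  have \<nu>_mset: "image_mset \<nu> (mset_set UNIV) = image_mset lam (mset_set {1..k})"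
  proof -
    have "mset_set {1..k} = image_mset number (mset_set (UNIV :: 'k set))"
      using image_mset_mset_set[OF strict_mono_imp_inj_on[OF strict_mono_number]] number by metis
    then show ?thesis by (simp add: \<nu>_def image_mset.compositionality o_def)
  qed
  show ?thesis
  proof (rule iffI)
    assume L: "steady_state ?F (state x m v l) \<and> linearly_stable ?F (state x m v l)"
    then have m: "m = 0" and l: "l = 0"
      and grad: "gradient E x = 2 *\<^sub>R (\<Sum>i\<in>UNIV. (v i \<bullet> gradient E x) *\<^sub>R v i)"
      and stat: "\<And>i. A *v v i = (v i \<bullet> (A *v v i)) *\<^sub>R v i + 2 *\<^sub>R (\<Sum>j\<in>{..<i}. (v j \<bullet> (A *v v i)) *\<^sub>R v j)"
      unfolding steady by blast+
    define \<mu> where "\<mu> = (\<lambda>i. v i \<bullet> (A *v v i))"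
    interpret eigenframe A v \<mu>
      unfolding \<mu>_def by (rule stationary_directions_eigenframe[OF adj inj unit stat])
    have crit: "gradient E x = 0" using grad by (rule reflection_fixes_only_zero)
    obtain T where T: "\<And>i. linear (T i)"
      and F: "(?F has_derivative linearization \<alpha>1 \<alpha>2 \<zeta> T) (at (state x m v l))"
      using has_derivative_ahisd_rhs[OF E123(2,3) A_def crit] m l by metis
    have \<mu>_mono: "strict_mono \<mu>"
      using eigenvalue_increasing_if_stable[OF \<zeta> T F] L by (auto intro: strict_monoI)
    have "\<mu> i \<in> range \<nu>" for i
    proof -
      obtain R where "eigenvalues A = image_mset \<mu> (mset_set UNIV) + image_mset (\<lambda>u. u \<bullet> (A *v u)) (mset_set R)"
        by (rule eigenbasis_extending_frame)
      then have "\<mu> i \<in># image_mset lam (mset_set {1..d})"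
        unfolding eigs[folded A_def, symmetric] by simp
      then obtain p where p: "p \<in> {1..d}" "\<mu> i = lam p" by auto
      moreover have "\<mu> i < 0" using eigenvalue_negative_if_stable[OF \<zeta> T F] L by simp
      ultimately have "p \<in> {1..k}" using lam_pos split by fastforce
      then obtain j :: 'k where "p = number j" unfolding number[symmetric] by auto
      then show ?thesis using p(2) by (simp add: \<nu>_def)
    qed
    then have "range \<mu> \<subseteq> range \<nu>" by auto
    moreover have "card (range \<mu>) = card (range \<nu>)"
      using card_image[OF strict_mono_imp_inj_on[OF \<mu>_mono]] card_image[OF strict_mono_imp_inj_on[OF \<nu>_mono]]
      by simp
    ultimately have "range \<mu> = range \<nu>" by (intro card_subset_eq) auto
    then have "\<mu> = \<nu>" by (rule strict_mono_same_range_imp_eq[OF \<mu>_mono \<nu>_mono])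
    with eigenvector have "\<forall>i. hessian E x *v v i = lam (number i) *\<^sub>R v i"
      unfolding A_def by (simp add: \<nu>_def)
    moreover have "size (filter_mset (\<lambda>t. t < 0) (eigenvalues A)) = k"
    proof -
      have "i \<in> {1..k}" if "i \<in> {1..d}" "lam i < 0" for i
      proof (rule ccontr)
        assume "i \<notin> {1..k}"
        with that(1) have "i \<in> {k+1..d}" by auto
        with lam_pos that(2) show False by fastforce
      qed
      moreover have "i \<in> {1..d}" "lam i < 0" if "i \<in> {1..k}" for i
        using that lam_neg kd by auto
      ultimately have "{i \<in> {1..d}. lam i < 0} = {1..k}" by blast
      then show ?thesis unfolding eigs[folded A_def] by (simp add: filter_mset_image_mset)
    qed
    then have "index_saddle E k x"
      unfolding index_saddle_def A_def using crit assms(7) by blast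
    ultimately show "index_saddle E k x \<and> (\<forall>i. hessian E x *v v i = lam (number i) *\<^sub>R v i) \<and> m = 0 \<and> l = 0"
      using m l by blast
  next
    assume R: "index_saddle E k x \<and> (\<forall>i. hessian E x *v v i = lam (number i) *\<^sub>R v i) \<and> m = 0 \<and> l = 0"
    then have crit: "gradient E x = 0" and m: "m = 0" and l: "l = 0"
      and eig: "\<And>i. A *v v i = \<nu> i *\<^sub>R v i" by (auto simp: index_saddle_def A_def \<nu>_def)
    interpret eigenframe A v \<nu>
      by (rule orthonormal_if_distinct_eigenvalues[OF adj unit eig strict_mono_imp_inj_on[OF \<nu>_mono]])
    have "(\<Sum>j\<in>{..<i}. (v j \<bullet> (A *v v i)) *\<^sub>R v j) = 0" for i
      by (rule sum.neutral) (auto simp: eig orthonormal)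
    then have "steady_state ?F (state x m v l)"
      unfolding steady by (simp add: crit m l eig orthonormal)
    moreover
    obtain T where T: "\<And>i. linear (T i)"
      and F: "(?F has_derivative linearization \<alpha>1 \<alpha>2 \<zeta> T) (at (state x m v l))"
      using has_derivative_ahisd_rhs[OF E123(2,3) A_def crit] m l by metis
    obtain R where R: "finite R" "span (range v \<union> R) = UNIV" "\<forall>u\<in>R. \<forall>i. u \<bullet> v i = 0"
      "\<forall>u\<in>R. A *v u = (u \<bullet> (A *v u)) *\<^sub>R u"
      and mset: "eigenvalues A = image_mset \<nu> (mset_set UNIV) + image_mset (\<lambda>u. u \<bullet> (A *v u)) (mset_set R)"
      by (rule eigenbasis_extending_frame)
    have rest: "image_mset (\<lambda>u. u \<bullet> (A *v u)) (mset_set R) = image_mset lam (mset_set {k+1..d})"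
      using mset unfolding eigs[folded A_def] mset_split \<nu>_mset by simp
    have "\<forall>u\<in>R. u \<bullet> (A *v u) > 0"
    proof
      fix u assume "u \<in> R"
      have "u \<bullet> (A *v u) \<in># image_mset lam (mset_set {k+1..d})"
        unfolding rest[symmetric] using \<open>u \<in> R\<close> R(1) by simp
      then show "u \<bullet> (A *v u) > 0" using lam_pos by auto
    qed
    then have "linearly_stable ?F (state x m v l)"
      by (rule stable_if_lowest[OF \<alpha>1 \<alpha>2 \<zeta> T F \<nu>_neg \<nu>_mono R(2-4)])
    ultimately show "steady_state ?F (state x m v l) \<and> linearly_stable ?F (state x m v l)" by simp
  qed
qed

end
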